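(* Let $\Gamma$ be a finitely generated group, let $G_{\mathbb{C}}$ be one of the groups $\mathrm{GL}(n,\mathbb{C})$, $\mathrm{SL}(n,\mathbb{C})$, $\mathrm{O}(n,\mathbb{C})$, $\mathrm{SO}(n,\mathbb{C})$ and $\mathrm{Sp}(2n,\mathbb{C})$, and let $K$ be its compact real form. Then $\mathcal{X}_K(\Gamma)$ is homeomorphic to the topological quotient $\mathrm{Hom}(\Gamma,K)/K$, where $K$ acts by conjugation.
   Context: $n$ is a positive integer. $\mathrm{O}(n,\mathbb{C})=\{M\in\mathrm{GL}(n,\mathbb{C}): M^{T}M=I_n\}$, $\mathrm{SO}(n,\mathbb{C})=\mathrm{O}(n,\mathbb{C})\cap\mathrm{SL}(n,\mathbb{C})$, $\mathrm{Sp}(2n,\mathbb{C})=\{M\in\mathrm{SL}(2n,\mathbb{C}): M^{T}JM=J\}$ with $J=\begin{pmatrix}0&I_n\\-I_n&0\end{pmatrix}$. The compact real form $K\subset G_{\mathbb{C}}$ is, respectively, $\mathrm{U}(n)$, $\mathrm{SU}(n)$, $\mathrm{O}(n)$ (real orthogonal group), $\mathrm{SO}(n)$ (real special orthogonal group), and $\mathrm{Sp}(2n,0)=\mathrm{Sp}(2n,\mathbb{C})\cap\mathrm{U}(2n)$. $\mathrm{Hom}(\Gamma,G_{\mathbb{C}})$ is an affine algebraic set (via the images of a finite generating set $\gamma_1,\dots,\gamma_s$ of $\Gamma$, i.e. as a subset of $G_{\mathbb{C}}^s$), on which $G_{\mathbb{C}}$ acts by conjugation; $\mathrm{Hom}(\Gamma,K)\subset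 K^s$ has the subspace topology. $\mathcal{X}_{G_{\mathbb{C}}}(\Gamma)=\mathrm{Hom}(\Gamma,G_{\mathbb{C}})//G_{\mathbb{C}}$ is the GIT quotient as an affine algebraic set: choosing generators $f_1,\dots,f_k$ of the algebra $\mathbb{C}[\mathrm{Hom}(\Gamma,G_{\mathbb{C}})]^{G_{\mathbb{C}}}$ of conjugation-invariant regular functions, it is identified with the image in $\mathbb{C}^k$ of $\rho\mapsto(f_1(\rho),\dots,f_k(\rho))$, and carries the usual (Euclidean) topology. The $K$-character variety $\mathcal{X}_K(\Gamma)$ is the image of $\mathrm{Hom}(\Gamma,K)$ under the projection $\mathrm{Hom}(\Gamma,G_{\mathbb{C}})\to\mathcal{X}_{G_{\mathbb{C}}}(\Gamma)$, with the subspace topology. *)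

theory Defs
  imports "HOL-Analysis.Analysis" "HOL-Algebra.Generated_Groups"
begin

section \<open>The complex groups and their compact real forms\<close>

type_synonym 'n cmatrix = "complex ^ 'n ^ 'n"

definition GL :: "'n::finite cmatrix set"
  where "GL = {M. invertible M}"

definition SL :: "'n::finite cmatrix set"
  where "SL = {M. det M = 1}"

definition O_complex :: "'n::finite cmatrix set"
  where "O_complex = {M \<in> GL. transpose M ** M = mat 1}"

definition SO_complex :: "'n::finite cmatrix set"
  where "SO_complex = O_complex \<inter> SL"

text \<open>A \<open>2n \<times> 2n\<close> matrix is indexed by \<open>'n + 'n\<close>; the summands \<open>Inl\<close> and \<open>Inr\<close> index the first
  and the second block of rows or columns.\<close>

definition J :: "('n::finite + 'n) cmatrix"
  where "J = (\<chi> a b. case (a, b) of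
                 (Inl i, Inr j) \<Rightarrow> if i = j then 1 else 0
               | (Inr i, Inl j) \<Rightarrow> if i = j then - 1 else 0
               | _ \<Rightarrow> 0)"

definition Sp_complex :: "('n::finite + 'n) cmatrix set"
  where "Sp_complex = {M \<in> SL. transpose M ** J ** M = J}"

definition U_compact :: "'n::finite cmatrix set"
  where "U_compact = {M. map_matrix cnj (transpose M) ** M = mat 1}"

definition SU_compact :: "'n::finite cmatrix set"
  where "SU_compact = U_compact \<inter> SL"

definition O_compact :: "'n::finite cmatrix set"
  where "O_compact = map_matrix complex_of_real ` {A. orthogonal_matrix A}"

definition SO_compact :: "'n::finite cmatrix set"
  where "SO_compact = map_matrix complex_of_real ` {A. orthogonal_matrix A \<and> det A = 1}"

definition Sp_compact :: "('n::finite + 'n) cmatrix set"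
  where "Sp_compact = Sp_complex \<inter> U_compact"


section \<open>Representations as tuples of matrices\<close>

definition matrix_group :: "'m::finite cmatrix set \<Rightarrow> 'm cmatrix monoid"
  where "matrix_group G = \<lparr>carrier = G, mult = (**), one = mat 1\<rparr>"

text \<open>\<open>Hom(\<Gamma>, G)\<close> as a subset of \<open>G\<^sup>s\<close>, by the images of the generators
  \<open>\<gamma> 0, \<dots>, \<gamma> (s - 1)\<close> of \<open>\<Gamma>\<close>.  An \<open>s\<close>-tuple is a function on \<open>{..<s}\<close>, extended by
  \<^const>\<open>undefined\<close> as usual for \<^const>\<open>product_topology\<close>.\<close>

definition Hom :: "('g, 'z) monoid_scheme \<Rightarrow> nat \<Rightarrow> (nat \<Rightarrow> 'g)
    \<Rightarrow> 'm::finite cmatrix set \<Rightarrow> (nat \<Rightarrow> 'm cmatrix) set"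
  where "Hom \<Gamma> s \<gamma> G = (\<lambda>\<rho>. \<lambda>i\<in>{..<s}. \<rho> (\<gamma> i)) ` hom \<Gamma> (matrix_group G)"

definition conjugate :: "nat \<Rightarrow> 'm::finite cmatrix \<Rightarrow> (nat \<Rightarrow> 'm cmatrix) \<Rightarrow> (nat \<Rightarrow> 'm cmatrix)"
  where "conjugate s g A = (\<lambda>i\<in>{..<s}. g ** A i ** matrix_inv g)"

definition Hom_topology :: "('g, 'z) monoid_scheme \<Rightarrow> nat \<Rightarrow> (nat \<Rightarrow> 'g)
    \<Rightarrow> 'm::finite cmatrix set \<Rightarrow> (nat \<Rightarrow> 'm cmatrix) topology"
  where "Hom_topology \<Gamma> s \<gamma> K =
           subtopology (product_topology (\<lambda>_. top_of_set K) {..<s}) (Hom \<Gamma> s \<gamma> K)"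


section \<open>The topological quotient by conjugation\<close>

text \<open>The quotient topology on a partition \<open>P\<close> of the points of \<open>X\<close>.\<close>

definition quotient_topology :: "'a topology \<Rightarrow> 'a set set \<Rightarrow> 'a set topology"
  where "quotient_topology X P = topology (\<lambda>\<U>. \<U> \<subseteq> P \<and> openin X (\<Union>\<U>))"

lemma openin_quotient_topology:
  assumes "disjoint P"
  shows "openin (quotient_topology X P) \<U> \<longleftrightarrow> \<U> \<subseteq> P \<and> openin X (\<Union>\<U>)"
proof -
  have I: "\<Union>(\<U> \<inter> \<V>) = \<Union>\<U> \<inter> \<Union>\<V>" if "\<U> \<subseteq> P" "\<V> \<subseteq> P" for \<U> \<V>
  proof -
    have "A = B" if "A \<in> \<U>" "B \<in> \<V>" "x \<in> A" "x \<in> B" for A B x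
      using disjointD[OF assms, of A B] \<open>\<U> \<subseteq> P\<close> \<open>\<V> \<subseteq> P\<close> that by blast
    then show ?thesis by blast
  qed
  have U: "\<Union>(\<Union>\<K>) = (\<Union>\<U>\<in>\<K>. \<Union>\<U>)" for \<K> :: "'a set set set"
    by blast
  have "istopology (\<lambda>\<U>. \<U> \<subseteq> P \<and> openin X (\<Union>\<U>))"
    unfolding istopology_def
  proof (intro conjI allI impI)
    fix \<U> \<V>
    assume "\<U> \<subseteq> P \<and> openin X (\<Union>\<U>)" "\<V> \<subseteq> P \<and> openin X (\<Union>\<V>)"
    then show "\<U> \<inter> \<V> \<subseteq> P" "openin X (\<Union>(\<U> \<inter> \<V>))"
      by (blast, simp add: I openin_Int)
  next
    fix \<K>
    assume "\<forall>\<U>\<in>\<K>. \<U> \<subseteq> P \<and> openin X (\<Union>\<U>)"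
    then show "\<Union>\<K> \<subseteq> P" "openin X (\<Union>(\<Union>\<K>))"
      unfolding U by (blast, blast intro: openin_Union)
  qed
  then show ?thesis
    by (simp add: quotient_topology_def topology_inverse')
qed

definition conjugacy_orbits :: "nat \<Rightarrow> 'm::finite cmatrix set \<Rightarrow> (nat \<Rightarrow> 'm cmatrix) set
    \<Rightarrow> (nat \<Rightarrow> 'm cmatrix) set set"
  where "conjugacy_orbits s K H = (\<lambda>A. (\<lambda>g. conjugate s g A) ` K) ` H"

definition Hom_mod_conjugation :: "('g, 'z) monoid_scheme \<Rightarrow> nat \<Rightarrow> (nat \<Rightarrow> 'g)
    \<Rightarrow> 'm::finite cmatrix set \<Rightarrow> (nat \<Rightarrow> 'm cmatrix) set topology"
  where "Hom_mod_conjugation \<Gamma> s \<gamma> K =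
           quotient_topology (Hom_topology \<Gamma> s \<gamma> K) (conjugacy_orbits s K (Hom \<Gamma> s \<gamma> K))"


section \<open>Regular functions and character varieties\<close>

text \<open>The unital \<open>\<complex>\<close>-algebra of functions on \<open>X\<close> generated by the restrictions to \<open>X\<close> of the
  functions in \<open>F\<close>.  Functions on \<open>X\<close> are taken in \<^term>\<open>extensional X\<close>, so that equality of
  such functions is equality on \<open>X\<close>.\<close>

inductive_set algebra_on :: "'a set \<Rightarrow> ('a \<Rightarrow> complex) set \<Rightarrow> ('a \<Rightarrow> complex) set"
  for X F where
  gen: "f \<in> F \<Longrightarrow> restrict f X \<in> algebra_on X F"
| const: "restrict (\<lambda>_. c) X \<in> algebra_on X F"
| add: "\<lbrakk>p \<in> algebra_on X F; q \<in> algebra_on X F\<rbrakk> \<Longrightarrow> restrict (\<lambda>x. p x + q x) X \<in> algebra_on X F"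
| mult: "\<lbrakk>p \<in> algebra_on X F; q \<in> algebra_on X F\<rbrakk> \<Longrightarrow> restrict (\<lambda>x. p x * q x) X \<in> algebra_on X F"

text \<open>\<open>GL(n, \<complex>)\<^sup>s\<close> is an affine algebraic set with coordinates the matrix entries and the inverses
  of the determinants; regular functions on a closed subset are restrictions of polynomials in
  these.\<close>

definition coordinate_functions :: "nat \<Rightarrow> ((nat \<Rightarrow> 'm::finite cmatrix) \<Rightarrow> complex) set"
  where "coordinate_functions s =
           {\<lambda>A. A i $ a $ b | i a b. i < s} \<union> {\<lambda>A. inverse (det (A i)) | i. i < s}"

definition regular_functions :: "nat \<Rightarrow> (nat \<Rightarrow> 'm::finite cmatrix) set
    \<Rightarrow> ((nat \<Rightarrow> 'm cmatrix) \<Rightarrow> complex) set"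
  where "regular_functions s H = algebra_on H (coordinate_functions s)"

definition invariant_functions :: "nat \<Rightarrow> 'm::finite cmatrix set \<Rightarrow> (nat \<Rightarrow> 'm cmatrix) set
    \<Rightarrow> ((nat \<Rightarrow> 'm cmatrix) \<Rightarrow> complex) set"
  where "invariant_functions s G H =
           {p \<in> regular_functions s H. \<forall>g\<in>G. \<forall>A\<in>H. p (conjugate s g A) = p A}"

definition generates_invariants :: "('g, 'z) monoid_scheme \<Rightarrow> nat \<Rightarrow> (nat \<Rightarrow> 'g)
    \<Rightarrow> 'm::finite cmatrix set \<Rightarrow> nat \<Rightarrow> (nat \<Rightarrow> (nat \<Rightarrow> 'm cmatrix) \<Rightarrow> complex) \<Rightarrow> bool"
  where "generates_invariants \<Gamma> s \<gamma> G k f \<longleftrightarrow>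
           algebra_on (Hom \<Gamma> s \<gamma> G) (f ` {..<k}) = invariant_functions s G (Hom \<Gamma> s \<gamma> G)"

definition projection :: "nat \<Rightarrow> (nat \<Rightarrow> (nat \<Rightarrow> 'm cmatrix) \<Rightarrow> complex)
    \<Rightarrow> (nat \<Rightarrow> 'm::finite cmatrix) \<Rightarrow> (nat \<Rightarrow> complex)"
  where "projection k f A = (\<lambda>j\<in>{..<k}. f j A)"

text \<open>The quotient \<open>Hom(\<Gamma>, G)//G\<close>, embedded in \<open>\<complex>\<^sup>k\<close> by the generators \<open>f 0, \<dots>, f (k - 1)\<close>
  of the algebra of invariants, and in it the image of \<open>Hom(\<Gamma>, K)\<close>.\<close>

definition git_quotient :: "('g, 'z) monoid_scheme \<Rightarrow> nat \<Rightarrow> (nat \<Rightarrow> 'g) \<Rightarrow> 'm::finite cmatrix set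
    \<Rightarrow> nat \<Rightarrow> (nat \<Rightarrow> (nat \<Rightarrow> 'm cmatrix) \<Rightarrow> complex) \<Rightarrow> (nat \<Rightarrow> complex) topology"
  where "git_quotient \<Gamma> s \<gamma> G k f =
           subtopology (product_topology (\<lambda>_. euclidean) {..<k}) (projection k f ` Hom \<Gamma> s \<gamma> G)"

definition compact_character_variety :: "('g, 'z) monoid_scheme \<Rightarrow> nat \<Rightarrow> (nat \<Rightarrow> 'g)
    \<Rightarrow> 'm::finite cmatrix set \<Rightarrow> 'm cmatrix set
    \<Rightarrow> nat \<Rightarrow> (nat \<Rightarrow> (nat \<Rightarrow> 'm cmatrix) \<Rightarrow> complex) \<Rightarrow> (nat \<Rightarrow> complex) topology"
  where "compact_character_variety \<Gamma> s \<gamma> G K k f =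
           subtopology (git_quotient \<Gamma> s \<gamma> G k f) (projection k f ` Hom \<Gamma> s \<gamma> K)"

end

theory Submission
  imports Defs "HOL-Complex_Analysis.Conformal_Mappings"
begin

text \<open>The projection restricts to a continuous surjection from the compact space \<open>Hom(\<Gamma>, K)\<close> onto the
Hausdorff space \<open>\<X>\<^sub>K(\<Gamma>)\<close>, hence to a quotient map, and so is the orbit map onto \<open>Hom(\<Gamma>, K)/K\<close>.
Two quotient maps from one space with the same fibres have homeomorphic targets, and a \<open>K\<close>-orbit
clearly lies in a fibre of the projection.  The content of the theorem is the converse: conjugation
invariants of \<open>G\<close> separate the \<open>K\<close>-orbits of unitary representations
(\<open>invariants_separate_unitary_orbits\<close>).

Let \<open>X\<close> and \<open>Y\<close> be two distinct, hence disjoint, \<open>K\<close>-orbits.  They are compact, and on unitary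
tuples the conjugate of a matrix entry is an entry of the inverse matrix, which is a regular
function.  By Stone-Weierstrass there is a regular function \<open>p\<close> whose real part is small on \<open>X\<close> and
large on \<open>Y\<close> (\<open>regular_separates_compact\<close>).  Averaging \<open>p\<close> over \<open>K\<close> keeps both inequalities and
makes it \<open>K\<close>-invariant, and a \<open>K\<close>-invariant regular function is \<open>G\<close>-invariant by the unitarian trick.

The average (\<open>bounded_group_average\<close>) is obtained without Haar measure.  The translates of \<open>p\<close> span a
finite-dimensional space of functions.  On their convex hull, the supremum over \<open>K\<close> of the
translates of a Euclidean norm is invariant and uniformly convex, so a minimizing sequence
converges and its limit is fixed by \<open>K\<close>.

The unitarian trick (\<open>unitary_invariant_imp_invariant\<close>) rests on the polar decomposition
\<open>g = u P\<^bsup>1/2\<^esup>\<close> with \<open>P = g\<^sup>* g\<close>.  By the spectral theorem \<open>P\<close> has complex powers \<open>P\<^bsup>z\<^esup>\<close>, which are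
unitary for imaginary \<open>z\<close>, and for each of the five groups they stay in \<open>G\<close>
(\<open>polar_group_GL\<close>, \<open>polar_group_SL\<close>, \<open>polar_group_isometries\<close>).  So every \<open>g\<close> is the value at \<open>1\<close> of
an entire curve in \<open>G\<close> that maps the imaginary axis into \<open>K\<close> (\<open>complex_curve\<close>), and the identity
theorem extends invariance from \<open>K\<close> to \<open>G\<close>.\<close>


section \<open>Averaging a function over a bounded group of transformations\<close>

definition in_span :: "'x set \<Rightarrow> ('x \<Rightarrow> complex) set \<Rightarrow> ('x \<Rightarrow> complex) \<Rightarrow> bool"
  where "in_span X E q \<longleftrightarrow> (\<exists>c. \<forall>x\<in>X. q x = (\<Sum>e\<in>E. c e * e x))"

lemma in_span_cong:
  assumes "in_span X E p" "\<And>x. x \<in> X \<Longrightarrow> q x = p x"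
  shows "in_span X E q"
  using assms by (auto simp: in_span_def)

lemma in_span_base:
  assumes "finite E" "e \<in> E"
  shows "in_span X E e"
proof -
  have "(\<Sum>e'\<in>E. (if e' = e then 1 else 0) * e' x) = e x" for x
  proof -
    have "(\<Sum>e'\<in>E. (if e' = e then 1 else 0) * e' x) = (\<Sum>e'\<in>E. if e' = e then e x else 0)"
      by (rule sum.cong) auto
    then show ?thesis using assms by simp
  qed
  then show ?thesis
    unfolding in_span_def by (intro exI[of _ "\<lambda>e'. if e' = e then 1 else 0"]) simp
qed

lemma in_span_add:
  assumes "in_span X E p" "in_span X E q"
  shows "in_span X E (\<lambda>x. p x + q x)"
proof -
  obtain c d where "\<forall>x\<in>X. p x = (\<Sum>e\<in>E. c e * e x)" "\<forall>x\<in>X. q x = (\<Sum>e\<in>E. d e * e x)"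
    using assms by (auto simp: in_span_def)
  then show ?thesis
    unfolding in_span_def
    by (intro exI[of _ "\<lambda>e. c e + d e"]) (simp add: distrib_right sum.distrib)
qed

lemma in_span_scale:
  assumes "in_span X E p"
  shows "in_span X E (\<lambda>x. a * p x)"
proof -
  obtain c where "\<forall>x\<in>X. p x = (\<Sum>e\<in>E. c e * e x)"
    using assms by (auto simp: in_span_def)
  then show ?thesis
    unfolding in_span_def
    by (intro exI[of _ "\<lambda>e. a * c e"]) (simp add: sum_distrib_left mult.assoc)
qed

lemma in_span_sum:
  assumes "\<And>i. i \<in> I \<Longrightarrow> in_span X E (f i)"
  shows "in_span X E (\<lambda>x. \<Sum>i\<in>I. f i x)"
  using assms
proof (induction I rule: infinite_finite_induct)
  case (insert i I)
  then have "in_span X E (\<lambda>x. f i x + (\<Sum>i\<in>I. f i x))"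
    by (intro in_span_add) auto
  then show ?case using insert by simp
qed (auto simp: in_span_def intro: exI[of _ "\<lambda>_. 0"])

lemma in_span_mono:
  assumes "in_span X E p" "E \<subseteq> F" "finite F"
  shows "in_span X F p"
proof -
  obtain c where c: "\<forall>x\<in>X. p x = (\<Sum>e\<in>E. c e * e x)"
    using assms by (auto simp: in_span_def)
  have "in_span X F (\<lambda>x. \<Sum>e\<in>E. c e * e x)"
    using assms by (intro in_span_sum in_span_scale in_span_base) auto
  then show ?thesis by (rule in_span_cong) (simp add: c)
qed

text \<open>Lagrange interpolation in a finite-dimensional space of functions: values at finitely many nodes
determine a function in the span, linearly and with coefficients in the span itself.  This replaces
convergence in the space of functions by convergence at the nodes.  The induction adds the functions
of \<open>E\<close> one at a time, and a new node is a point where the interpolation error of the new function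
does not vanish.\<close>

lemma span_interpolation:
  assumes "finite E"
  obtains Y h where "finite Y" "Y \<subseteq> X"
    and "\<And>y. y \<in> Y \<Longrightarrow> in_span X E (h y)"
    and "\<And>q x. in_span X E q \<Longrightarrow> x \<in> X \<Longrightarrow> q x = (\<Sum>y\<in>Y. q y * h y x)"
proof -
  have "\<exists>Y h. finite Y \<and> Y \<subseteq> X \<and> (\<forall>y\<in>Y. in_span X E (h y))
      \<and> (\<forall>y\<in>Y. \<forall>y'\<in>Y. h y y' = (if y = y' then 1 else 0))
      \<and> (\<forall>e\<in>E. \<forall>x\<in>X. e x = (\<Sum>y\<in>Y. e y * h y x))"
    using assms
  proof (induction E)
    case empty
    show ?case by (intro exI[of _ "{}"]) simp
  next
    case (insert e E)
    obtain Y h where Y: "finite Y" "Y \<subseteq> X" "\<forall>y\<in>Y. in_span X E (h y)"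
      and \<delta>: "\<And>y y'. y \<in> Y \<Longrightarrow> y' \<in> Y \<Longrightarrow> h y y' = (if y = y' then 1 else 0)"
      and int: "\<forall>e\<in>E. \<forall>x\<in>X. e x = (\<Sum>y\<in>Y. e y * h y x)"
      using insert.IH by blast
    have fin: "finite (insert e E)" using insert by simp
    have hE: "in_span X (insert e E) (h y)" if "y \<in> Y" for y
      using in_span_mono[of X E "h y" "insert e E"] Y that fin by blast
    \<comment> \<open>the interpolation error of the new function\<close>
    define r where "r x = e x - (\<Sum>y\<in>Y. e y * h y x)" for x
    have r: "in_span X (insert e E) r"
    proof (rule in_span_cong)
      show "in_span X (insert e E) (\<lambda>x. e x + (\<Sum>y\<in>Y. - e y * h y x))"
        by (intro in_span_add in_span_sum in_span_scale in_span_base[OF fin] hE) auto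
    qed (simp add: r_def sum_negf)
    \<comment> \<open>the duality of \<open>h\<close> and \<open>Y\<close> makes the error vanish at the old nodes\<close>
    have rY: "r y = 0" if "y \<in> Y" for y
    proof -
      have "(\<Sum>y'\<in>Y. e y' * h y' y) = (\<Sum>y'\<in>Y. if y' = y then e y else 0)"
        using that by (intro sum.cong) (auto simp: \<delta>)
      then show ?thesis using that Y by (simp add: r_def)
    qed
    show ?case
    proof (cases "\<forall>x\<in>X. r x = 0")
      case True
      then show ?thesis
        using Y \<delta> int hE by (intro exI[of _ Y] exI[of _ h]) (auto simp: r_def)
    next
      case False
      then obtain z where z: "z \<in> X" "r z \<noteq> 0" by blast
      then have zY: "z \<notin> Y" using rY by blast
      \<comment> \<open>normalize the error at the new node, and correct the old basis to vanish there\<close>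
      define h' where "h' y x = (if y = z then r x / r z else h y x - h y z * (r x / r z))" for y x
      have span: "in_span X (insert e E) (h' y)" if "y \<in> insert z Y" for y
      proof (cases "y = z")
        case True
        then show ?thesis
          using in_span_scale[OF r, of "1 / r z"] by (simp add: h'_def in_span_def)
      next
        case False
        then have "in_span X (insert e E) (\<lambda>x. h y x + (- h y z / r z) * r x)"
          using that by (intro in_span_add in_span_scale r hE) auto
        then show ?thesis using False by (simp add: h'_def[abs_def] in_span_def)
      qed
      have \<delta>': "h' y y' = (if y = y' then 1 else 0)" if "y \<in> insert z Y" "y' \<in> insert z Y" for y y'
        using that zY z rY \<delta> by (auto simp: h'_def)
      have exp: "(\<Sum>y\<in>insert z Y. q y * h' y x) = (\<Sum>y\<in>Y. q y * h y x)
                  + (q z - (\<Sum>y\<in>Y. q y * h y z)) * (r x / r z)" for q :: "'a \<Rightarrow> complex" and x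
      proof -
        have "(\<Sum>y\<in>Y. q y * h' y x) = (\<Sum>y\<in>Y. q y * h y x - q y * h y z * (r x / r z))"
          using zY by (intro sum.cong) (auto simp: h'_def algebra_simps)
        also have "\<dots> = (\<Sum>y\<in>Y. q y * h y x) - (\<Sum>y\<in>Y. q y * h y z) * (r x / r z)"
          by (simp add: sum_subtractf sum_distrib_right sum_divide_distrib)
        finally show ?thesis
          using zY Y by (simp add: h'_def algebra_simps diff_divide_distrib)
      qed
      have "e' x = (\<Sum>y\<in>insert z Y. e' y * h' y x)" if "e' \<in> insert e E" "x \<in> X" for e' x
      proof (cases "e' = e")
        case True
        then show ?thesis using z by (simp only: exp) (simp add: r_def)
      next
        case False
        then have "e' \<in> E" using that by simp
        then show ?thesis using int that z by (simp only: exp) simp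
      qed
      then show ?thesis
        using Y z span \<delta>' by (intro exI[of _ "insert z Y"] exI[of _ h']) auto
    qed
  qed
  then obtain Y h where Y: "finite Y" "Y \<subseteq> X" "\<forall>y\<in>Y. in_span X E (h y)"
      and int: "\<forall>e\<in>E. \<forall>x\<in>X. e x = (\<Sum>y\<in>Y. e y * h y x)" by blast
  have "q x = (\<Sum>y\<in>Y. q y * h y x)" if q: "in_span X E q" and x: "x \<in> X" for q x
  proof -
    obtain c where c: "\<forall>x\<in>X. q x = (\<Sum>e\<in>E. c e * e x)" using q by (auto simp: in_span_def)
    have "q x = (\<Sum>e\<in>E. c e * (\<Sum>y\<in>Y. e y * h y x))"
      unfolding c[rule_format, OF x] by (intro sum.cong) (use int x in auto)
    also have "\<dots> = (\<Sum>y\<in>Y. (\<Sum>e\<in>E. c e * e y) * h y x)"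
      by (simp add: sum_distrib_left sum_distrib_right mult.assoc) (rule sum.swap)
    also have "\<dots> = (\<Sum>y\<in>Y. q y * h y x)"
      using c Y by (intro sum.cong) auto
    finally show ?thesis .
  qed
  then show thesis using that Y by blast
qed

text \<open>The dyadic convex combinations of the translates of \<open>p\<close>.  Closure under midpoints is all of convexity
that the parallelogram argument below uses.\<close>

inductive_set midpoint_hull :: "('x \<Rightarrow> 'x) set \<Rightarrow> ('x \<Rightarrow> complex) \<Rightarrow> ('x \<Rightarrow> complex) set"
  for T p where
  translate: "t \<in> T \<Longrightarrow> (\<lambda>x. p (t x)) \<in> midpoint_hull T p"
| midpoint: "\<lbrakk>q \<in> midpoint_hull T p; r \<in> midpoint_hull T p\<rbrakk>
    \<Longrightarrow> (\<lambda>x. (q x + r x) / 2) \<in> midpoint_hull T p"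

lemma midpoint_hull_translate:
  assumes "\<And>t t'. t \<in> T \<Longrightarrow> t' \<in> T \<Longrightarrow> t \<circ> t' \<in> T"
    and "q \<in> midpoint_hull T p" "t \<in> T"
  shows "(\<lambda>x. q (t x)) \<in> midpoint_hull T p"
  using assms(2)
proof induction
  case (translate u)
  show ?case
    using midpoint_hull.translate[OF assms(1)[OF translate assms(3)], of p] by simp
next
  case (midpoint q r)
  show ?case using midpoint_hull.midpoint[OF midpoint.IH] .
qed

lemma Cauchy_Schwarz_complex_sum:
  fixes a b :: "'x \<Rightarrow> complex"
  shows "(cmod (\<Sum>y\<in>Y. a y * b y))\<^sup>2 \<le> (\<Sum>y\<in>Y. (cmod (a y))\<^sup>2) * (\<Sum>y\<in>Y. (cmod (b y))\<^sup>2)"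
proof -
  have "cmod (\<Sum>y\<in>Y. a y * b y) \<le> (\<Sum>y\<in>Y. cmod (a y) * cmod (b y))"
    by (rule order_trans[OF norm_sum]) (simp add: norm_mult)
  then have "(cmod (\<Sum>y\<in>Y. a y * b y))\<^sup>2 \<le> (\<Sum>y\<in>Y. cmod (a y) * cmod (b y))\<^sup>2"
    by (simp add: power_mono)
  also have "\<dots> \<le> (\<Sum>y\<in>Y. (cmod (a y))\<^sup>2) * (\<Sum>y\<in>Y. (cmod (b y))\<^sup>2)"
    by (rule Cauchy_Schwarz_ineq_sum)
  finally show ?thesis .
qed

lemma parallelogram_midpoint:
  fixes a b :: complex
  shows "(cmod (a - b))\<^sup>2 = 2 * (cmod a)\<^sup>2 + 2 * (cmod b)\<^sup>2 - 4 * (cmod ((a + b) / 2))\<^sup>2"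
  unfolding cmod_power2 by (simp add: power2_eq_square field_simps)

text \<open>Measure the elements \<open>q\<close> of the hull of the translates by \<open>\<Phi> q\<close>, the supremum over \<open>t \<in> T\<close> of the
squared Euclidean norm of \<open>q \<circ> t\<close> on interpolation nodes.  As a supremum over the group \<open>\<Phi>\<close> does not
increase under translation, and it inherits the parallelogram inequality from the Euclidean norm:
two near-minimizers are close to each other at every point, since otherwise their midpoint would
have a value below the infimum.  So a minimizing sequence converges pointwise, and it has the same
limit as its translates.  Bounds on the real part pass from the translates of \<open>p\<close> to the hull and to
the limit.\<close>

proposition bounded_group_average:
  fixes X :: "'x set" and T :: "('x \<Rightarrow> 'x) set" and p :: "'x \<Rightarrow> complex"
  assumes T_ne: "T \<noteq> {}"
    and T_X: "\<And>t x. t \<in> T \<Longrightarrow> x \<in> X \<Longrightarrow> t x \<in> X"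
    and T_comp: "\<And>t t'. t \<in> T \<Longrightarrow> t' \<in> T \<Longrightarrow> t \<circ> t' \<in> T"
    and T_inv: "\<And>t. t \<in> T \<Longrightarrow> \<exists>t'\<in>T. \<forall>x\<in>X. t (t' x) = x"
    and E: "finite E"
    and p_span: "\<And>t. t \<in> T \<Longrightarrow> in_span X E (\<lambda>x. p (t x))"
    and bdd: "\<And>e x. e \<in> E \<Longrightarrow> x \<in> X \<Longrightarrow> bounded ((\<lambda>t. e (t x)) ` T)"
  obtains q where "in_span X E q"
    and "\<And>t x. t \<in> T \<Longrightarrow> x \<in> X \<Longrightarrow> q (t x) = q x"
    and "\<And>x a. x \<in> X \<Longrightarrow> (\<And>t. t \<in> T \<Longrightarrow> Re (p (t x)) \<le> a) \<Longrightarrow> Re (q x) \<le> a"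
    and "\<And>x a. x \<in> X \<Longrightarrow> (\<And>t. t \<in> T \<Longrightarrow> a \<le> Re (p (t x))) \<Longrightarrow> a \<le> Re (q x)"
proof -
  obtain Y h where Y: "finite Y" "Y \<subseteq> X"
    and h: "\<And>y. y \<in> Y \<Longrightarrow> in_span X E (h y)"
    and int: "\<And>q x. in_span X E q \<Longrightarrow> x \<in> X \<Longrightarrow> q x = (\<Sum>y\<in>Y. q y * h y x)"
    using span_interpolation[OF E] by blast
  let ?C = "midpoint_hull T p"
  have C_span: "in_span X E q" if "q \<in> ?C" for q
    using that
  proof induction
    case (midpoint q r)
    then have "in_span X E (\<lambda>x. (1/2) * (q x + r x))"
      by (intro in_span_scale in_span_add)
    then show ?case by simp
  qed (rule p_span)
  have C_T: "(\<lambda>x. q (t x)) \<in> ?C" if "q \<in> ?C" "t \<in> T" for q t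
    using midpoint_hull_translate[OF T_comp] that by blast
  have span_bdd: "\<exists>B\<ge>0. \<forall>t\<in>T. cmod (q (t x)) \<le> B" if q: "in_span X E q" and x: "x \<in> X" for q x
  proof -
    obtain c where c: "\<forall>x\<in>X. q x = (\<Sum>e\<in>E. c e * e x)" using q by (auto simp: in_span_def)
    have "\<exists>B. \<forall>e\<in>E. \<forall>t\<in>T. cmod (e (t x)) \<le> B e"
    proof -
      have "\<forall>e\<in>E. \<exists>B. \<forall>t\<in>T. cmod (e (t x)) \<le> B"
        using bdd[OF _ x] unfolding bounded_iff by fastforce
      then show ?thesis by (rule bchoice)
    qed
    then obtain B where B: "\<And>e t. e \<in> E \<Longrightarrow> t \<in> T \<Longrightarrow> cmod (e (t x)) \<le> B e" by blast
    have "cmod (q (t x)) \<le> (\<Sum>e\<in>E. cmod (c e) * B e)" if "t \<in> T" for t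
    proof -
      have "cmod (q (t x)) \<le> (\<Sum>e\<in>E. cmod (c e * e (t x)))"
        using c T_X[OF that x] by (simp add: norm_sum)
      also have "\<dots> \<le> (\<Sum>e\<in>E. cmod (c e) * B e)"
        by (rule sum_mono) (simp add: norm_mult B that mult_left_mono)
      finally show ?thesis .
    qed
    then show ?thesis
      by (intro exI[of _ "max 0 (\<Sum>e\<in>E. cmod (c e) * B e)"]) (auto simp: le_max_iff_disj)
  qed
  \<comment> \<open>the squared norm of \<open>q \<circ> t\<close> on the nodes\<close>
  define S where "S q t = (\<Sum>y\<in>Y. (cmod (q (t y)))\<^sup>2)" for q :: "'x \<Rightarrow> complex" and t :: "'x \<Rightarrow> 'x"
  have S_nonneg: "S q t \<ge> 0" for q t
    by (simp add: S_def sum_nonneg)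
  have S_bdd: "bdd_above (S q ` T)" if "in_span X E q" for q
  proof -
    have "\<forall>y\<in>Y. \<exists>B. \<forall>t\<in>T. cmod (q (t y)) \<le> B"
      using span_bdd[OF that] Y by blast
    then obtain B where B: "\<And>y t. y \<in> Y \<Longrightarrow> t \<in> T \<Longrightarrow> cmod (q (t y)) \<le> B y"
      by metis
    have "S q t \<le> (\<Sum>y\<in>Y. (B y)\<^sup>2)" if "t \<in> T" for t
      unfolding S_def by (intro sum_mono power_mono B that) auto
    then show ?thesis by (auto intro!: bdd_aboveI2)
  qed
  define \<Phi> where "\<Phi> q = (SUP t\<in>T. S q t)" for q
  have S_le: "S q t \<le> \<Phi> q" if "q \<in> ?C" "t \<in> T" for q t
    unfolding \<Phi>_def using that S_bdd C_span by (intro cSUP_upper) auto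
  have \<Phi>_nonneg: "\<Phi> q \<ge> 0" if "q \<in> ?C" for q
    using T_ne S_le[OF that] S_nonneg[of q] by (meson all_not_in_conv order_trans)
  have \<Phi>_T: "\<Phi> (\<lambda>x. q (t x)) \<le> \<Phi> q" if "q \<in> ?C" "t \<in> T" for q t
  proof -
    have "S (\<lambda>x. q (t x)) u \<le> \<Phi> q" if "u \<in> T" for u
      using S_le[OF \<open>q \<in> ?C\<close> T_comp[OF \<open>t \<in> T\<close> that]] by (simp add: S_def)
    then show ?thesis
      unfolding \<Phi>_def[of "\<lambda>x. q (t x)"] by (intro cSUP_least T_ne)
  qed
  define m where "m = (INF q\<in>?C. \<Phi> q)"
  have C_ne: "?C \<noteq> {}" using T_ne midpoint_hull.translate by blast
  have m_le: "m \<le> \<Phi> q" if "q \<in> ?C" for q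
    unfolding m_def using that \<Phi>_nonneg by (intro cINF_lower) (auto intro!: bdd_belowI2)
  have close: "\<exists>B\<ge>0. \<forall>\<epsilon>>0. \<forall>q\<in>?C. \<forall>r\<in>?C. \<Phi> q \<le> m + \<epsilon> \<longrightarrow> \<Phi> r \<le> m + \<epsilon>
        \<longrightarrow> (cmod (q x - r x))\<^sup>2 \<le> B * \<epsilon>" if x: "x \<in> X" for x
  proof -
    have "\<forall>y\<in>Y. \<exists>B. B \<ge> 0 \<and> (\<forall>t\<in>T. cmod (h y (t x)) \<le> B)"
      using span_bdd[OF h x] by blast
    then obtain B where B: "\<And>y t. y \<in> Y \<Longrightarrow> t \<in> T \<Longrightarrow> cmod (h y (t x)) \<le> B y"
      by metis
    have "(cmod (q x - r x))\<^sup>2 \<le> 8 * (\<Sum>y\<in>Y. (B y)\<^sup>2) * \<epsilon>"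
      if \<epsilon>: "\<epsilon> > 0" and q: "q \<in> ?C" "\<Phi> q \<le> m + \<epsilon>" and r: "r \<in> ?C" "\<Phi> r \<le> m + \<epsilon>" for \<epsilon> q r
    proof -
      let ?d = "\<lambda>x. q x - r x"
      have mid: "(\<lambda>x. (q x + r x) / 2) \<in> ?C"
        using q r by (intro midpoint_hull.midpoint)
      have "m - \<epsilon> < \<Phi> (\<lambda>x. (q x + r x) / 2)"
        using m_le[OF mid] \<epsilon> by linarith
      \<comment> \<open>the midpoint is in the hull, so some translate of it has almost the minimal value\<close>
      then obtain t where t: "t \<in> T" "m - \<epsilon> < S (\<lambda>x. (q x + r x) / 2) t"
        unfolding \<Phi>_def using less_cSUP_iff[OF T_ne S_bdd[OF C_span[OF mid]]] by blast
      have "S ?d t = 2 * S q t + 2 * S r t - 4 * S (\<lambda>x. (q x + r x) / 2) t"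
        unfolding S_def by (simp add: parallelogram_midpoint sum.distrib sum_subtractf sum_distrib_left)
      then have Sd: "S ?d t \<le> 8 * \<epsilon>"
        using S_le[OF q(1) t(1)] S_le[OF r(1) t(1)] q(2) r(2) t(2) by linarith
      \<comment> \<open>smallness on the nodes after translation by \<open>t\<close> is smallness at \<open>x = t (u x)\<close> by interpolation\<close>
      obtain u where u: "u \<in> T" "t (u x) = x" using T_inv[OF t(1)] x by blast
      have d_span: "in_span X E (\<lambda>x. q (t x) - r (t x))"
      proof -
        have "in_span X E (\<lambda>x. q (t x) + (-1) * r (t x))"
          using C_T C_span q r t by (intro in_span_add in_span_scale) auto
        then show ?thesis by simp
      qed
      have "(cmod (q x - r x))\<^sup>2 = (cmod (\<Sum>y\<in>Y. (q (t y) - r (t y)) * h y (u x)))\<^sup>2"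
        using int[OF d_span T_X[OF u(1) x]] u by simp
      also have "\<dots> \<le> S ?d t * (\<Sum>y\<in>Y. (cmod (h y (u x)))\<^sup>2)"
        unfolding S_def by (rule Cauchy_Schwarz_complex_sum)
      also have "\<dots> \<le> 8 * \<epsilon> * (\<Sum>y\<in>Y. (B y)\<^sup>2)"
        using Sd \<epsilon> u B by (intro mult_mono sum_mono power_mono sum_nonneg) auto
      finally show ?thesis by (simp add: mult_ac)
    qed
    then show ?thesis
      by (intro exI[of _ "8 * (\<Sum>y\<in>Y. (B y)\<^sup>2)"]) (auto simp: sum_nonneg)
  qed
  have "\<exists>q\<in>?C. \<Phi> q < m + 1 / real (Suc n)" for n
  proof -
    have "(INF q\<in>?C. \<Phi> q) < m + 1 / real (Suc n)" by (simp add: m_def[symmetric])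
    moreover have "bdd_below (\<Phi> ` ?C)" using \<Phi>_nonneg by (auto intro!: bdd_belowI2)
    ultimately show ?thesis using cINF_less_iff[OF C_ne] by blast
  qed
  then obtain Q where Q: "\<And>n. Q n \<in> ?C" and Qm: "\<And>n. \<Phi> (Q n) < m + 1 / real (Suc n)"
    by metis
  have Q_close: "\<exists>B\<ge>0. \<forall>n. \<forall>q\<in>?C. \<Phi> q \<le> m + 1 / real (Suc n) \<longrightarrow> (cmod (q x - Q n x))\<^sup>2 \<le> B * (1 / real (Suc n))"
    if "x \<in> X" for x
  proof -
    obtain B where "B \<ge> 0" and B: "\<And>\<epsilon> q r. \<epsilon> > 0 \<Longrightarrow> q \<in> ?C \<Longrightarrow> r \<in> ?C \<Longrightarrow> \<Phi> q \<le> m + \<epsilon> \<Longrightarrow> \<Phi> r \<le> m + \<epsilon>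
        \<Longrightarrow> (cmod (q x - r x))\<^sup>2 \<le> B * \<epsilon>"
      using close[OF \<open>x \<in> X\<close>] by blast
    show ?thesis
      by (intro exI[of _ B] conjI allI ballI impI B Q less_imp_le[OF Qm] \<open>B \<ge> 0\<close>) auto
  qed
  have lim0: "(\<lambda>n. B * (1 / real (Suc n))) \<longlonglongrightarrow> 0" for B :: real
    using tendsto_mult_right_zero[OF LIMSEQ_inverse_real_of_nat] by (simp add: inverse_eq_divide)
  have "convergent (\<lambda>n. Q n x)" if x: "x \<in> X" for x
  proof -
    obtain B where B: "\<And>n q. q \<in> ?C \<Longrightarrow> \<Phi> q \<le> m + 1 / real (Suc n) \<Longrightarrow> (cmod (q x - Q n x))\<^sup>2 \<le> B * (1 / real (Suc n))"
      using Q_close[OF x] by blast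
    have "Cauchy (\<lambda>n. Q n x)"
    proof (rule CauchyI)
      fix e :: real assume e: "e > 0"
      have "\<forall>\<^sub>F n in sequentially. B * (1 / real (Suc n)) < (e/2)\<^sup>2"
        using e by (intro order_tendstoD(2)[OF lim0]) auto
      then obtain N where N: "B * (1 / real (Suc N)) < (e/2)\<^sup>2"
        by (auto simp: eventually_sequentially)
      have *: "cmod (Q n x - Q N x) < e/2" if "n \<ge> N" for n
      proof -
        have "1 / real (Suc n) \<le> 1 / real (Suc N)" using that by (simp add: frac_le)
        then have "(cmod (Q n x - Q N x))\<^sup>2 \<le> B * (1 / real (Suc N))"
          using Qm[of n] by (intro B Q) linarith
        then have "(cmod (Q n x - Q N x))\<^sup>2 < (e/2)\<^sup>2" using N by linarith
        then show ?thesis by (rule power_less_imp_less_base) (use e in simp)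
      qed
      have "cmod (Q i x - Q j x) < e" if "i \<ge> N" "j \<ge> N" for i j
        using *[OF that(1)] *[OF that(2)] norm_triangle_ineq4[of "Q i x - Q N x" "Q j x - Q N x"]
        by simp
      then show "\<exists>M. \<forall>i\<ge>M. \<forall>j\<ge>M. cmod (Q i x - Q j x) < e" by blast
    qed
    then show ?thesis by (simp add: Cauchy_convergent_iff)
  qed
  then obtain q where q: "\<And>x. x \<in> X \<Longrightarrow> (\<lambda>n. Q n x) \<longlonglongrightarrow> q x"
    unfolding convergent_def by metis
  have "in_span X E q"
  proof (rule in_span_cong)
    show "in_span X E (\<lambda>x. \<Sum>y\<in>Y. q y * h y x)"
      using h by (intro in_span_sum in_span_scale)
    fix x assume x: "x \<in> X"
    have "(\<lambda>n. \<Sum>y\<in>Y. Q n y * h y x) \<longlonglongrightarrow> (\<Sum>y\<in>Y. q y * h y x)"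
      using Y by (intro tendsto_intros q) auto
    then have "(\<lambda>n. Q n x) \<longlonglongrightarrow> (\<Sum>y\<in>Y. q y * h y x)"
      using int[OF C_span[OF Q] x] by simp
    then show "q x = (\<Sum>y\<in>Y. q y * h y x)"
      using q[OF x] LIMSEQ_unique by blast
  qed
  moreover have "q (t x) = q x" if t: "t \<in> T" and x: "x \<in> X" for t x
  proof -
    obtain B where B: "\<And>n q. q \<in> ?C \<Longrightarrow> \<Phi> q \<le> m + 1 / real (Suc n) \<Longrightarrow> (cmod (q x - Q n x))\<^sup>2 \<le> B * (1 / real (Suc n))"
      using Q_close[OF x] by blast
    have "(cmod (Q n (t x) - Q n x))\<^sup>2 \<le> B * (1 / real (Suc n))" for n
      using B[OF C_T[OF Q t], of n n] \<Phi>_T[OF Q t, of n] Qm[of n] by simp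
    moreover have "(\<lambda>n. (cmod (Q n (t x) - Q n x))\<^sup>2) \<longlonglongrightarrow> (cmod (q (t x) - q x))\<^sup>2"
      using T_X t x by (intro tendsto_intros q)
    ultimately have "(cmod (q (t x) - q x))\<^sup>2 \<le> 0"
      using LIMSEQ_le[OF _ lim0] by blast
    then show ?thesis by simp
  qed
  moreover have "Re (q x) \<le> a" if x: "x \<in> X" and le: "\<And>t. t \<in> T \<Longrightarrow> Re (p (t x)) \<le> a" for x a
  proof -
    have "Re (r x) \<le> a" if "r \<in> ?C" for r
      using that by induction (auto simp: le)
    then show ?thesis
      using Lim_bounded[OF tendsto_Re[OF q[OF x]]] Q by blast
  qed
  moreover have "a \<le> Re (q x)" if x: "x \<in> X" and ge: "\<And>t. t \<in> T \<Longrightarrow> a \<le> Re (p (t x))" for x a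
  proof -
    have "a \<le> Re (r x)" if "r \<in> ?C" for r
      using that by induction (auto simp: ge)
    then show ?thesis
      using Lim_bounded2[OF tendsto_Re[OF q[OF x]]] Q by blast
  qed
  ultimately show thesis using that by blast
qed

section \<open>Unitary matrices and the spectral theorem\<close>

lemma matrix_inv_eqI:
  fixes A B :: "'a::field^'n^'n"
  assumes "A ** B = mat 1"
  shows "matrix_inv A = B"
proof -
  have BA: "B ** A = mat 1" using assms matrix_left_right_inverse by blast
  have "A ** matrix_inv A = mat 1 \<and> matrix_inv A ** A = mat 1"
    unfolding matrix_inv_def by (rule someI[of _ B]) (simp add: assms BA)
  then have "B ** A ** matrix_inv A = B" by (simp add: matrix_mul_assoc[symmetric])
  then show ?thesis by (simp add: BA)
qed

lemma matrix_inv_right: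
  fixes A :: "'a::field^'n^'n"
  assumes "invertible A"
  shows "A ** matrix_inv A = mat 1" "matrix_inv A ** A = mat 1"
proof -
  obtain B where B: "A ** B = mat 1" using assms by (auto simp: invertible_def)
  then show "A ** matrix_inv A = mat 1" by (simp add: matrix_inv_eqI)
  then show "matrix_inv A ** A = mat 1" using matrix_left_right_inverse by blast
qed

lemma matrix_inv_mult:
  fixes A B :: "'a::field^'n^'n"
  assumes "invertible A" "invertible B"
  shows "matrix_inv (A ** B) = matrix_inv B ** matrix_inv A"
proof (rule matrix_inv_eqI)
  have "A ** B ** (matrix_inv B ** matrix_inv A) = A ** (B ** matrix_inv B) ** matrix_inv A"
    by (simp only: matrix_mul_assoc)
  then show "A ** B ** (matrix_inv B ** matrix_inv A) = mat 1"
    using assms by (simp add: matrix_inv_right)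
qed

abbreviation ctranspose :: "complex^'n^'m \<Rightarrow> complex^'m^'n"
  where "ctranspose A \<equiv> map_matrix cnj (transpose A)"

definition cinner :: "complex^'n \<Rightarrow> complex^'n \<Rightarrow> complex"
  where "cinner x y = (\<Sum>i\<in>UNIV. cnj (x $ i) * y $ i)"

lemma ctranspose_mult: "ctranspose (A ** B) = ctranspose B ** ctranspose A"
  by (simp add: vec_eq_iff matrix_matrix_mult_def transpose_def mult.commute)

lemma ctranspose_ctranspose: "ctranspose (ctranspose A) = A"
  by (simp add: vec_eq_iff transpose_def)

lemma ctranspose_mat_1: "ctranspose (mat 1) = mat 1"
  by (simp add: vec_eq_iff transpose_def mat_def)

lemma inner_eq_cinner: "x \<bullet> y = Re (cinner x y)"
  by (simp add: inner_vec_def cinner_def inner_complex_def)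

lemma cinner_self: "cinner x x = of_real ((norm x)\<^sup>2)"
proof -
  have "cinner x x = (\<Sum>i\<in>UNIV. of_real ((cmod (x $ i))\<^sup>2))"
    unfolding cinner_def
    by (rule sum.cong) (simp_all only: complex_norm_square mult.commute)
  then show ?thesis
    by (simp add: power2_norm_eq_inner inner_vec_def flip: of_real_sum)
qed

lemma cinner_commute: "cinner y x = cnj (cinner x y)"
  by (simp add: cinner_def mult.commute)

lemma cinner_matrix: "cinner (A *v x) y = cinner x (ctranspose A *v y)"
proof -
  have "cinner (A *v x) y = (\<Sum>i\<in>UNIV. \<Sum>j\<in>UNIV. cnj (A $ i $ j) * cnj (x $ j) * y $ i)"
    by (simp add: cinner_def matrix_vector_mult_def sum_distrib_right)
  also have "\<dots> = (\<Sum>j\<in>UNIV. \<Sum>i\<in>UNIV. cnj (A $ i $ j) * cnj (x $ j) * y $ i)"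
    by (rule sum.swap)
  also have "\<dots> = cinner x (ctranspose A *v y)"
    by (simp add: cinner_def matrix_vector_mult_def transpose_def sum_distrib_left mult_ac)
  finally show ?thesis .
qed

lemma cinner_right_add: "cinner x (y + z) = cinner x y + cinner x z"
  by (simp add: cinner_def distrib_left sum.distrib)

lemma cinner_right_scaleR: "cinner x (t *\<^sub>R y) = of_real t * cinner x y"
  by (simp add: cinner_def sum_distrib_left) (simp add: scaleR_conv_of_real mult_ac)

lemma matrix_vector_mult_scaleR_complex: "A *v (t *\<^sub>R x) = t *\<^sub>R (A *v (x :: complex^'n))"
  by (simp add: vec_eq_iff matrix_vector_mult_def scaleR_sum_right)

lemma cinner_right_scale: "cinner x (a *s y) = a * cinner x y"
  by (simp add: cinner_def sum_distrib_left mult_ac)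

lemma continuous_on_cinner: "continuous_on S (cinner x)"
  unfolding cinner_def by (intro continuous_intros)

text \<open>The first-order condition at a maximum, for a function that is quadratic in \<open>t\<close>.\<close>

lemma quadratic_nonpos_imp_linear_zero:
  fixes a c :: real
  assumes "\<And>t. 2 * t * a + t\<^sup>2 * c \<le> 0" and "a \<ge> 0"
  shows "a = 0"
proof (rule ccontr)
  assume "a \<noteq> 0"
  then have a: "a > 0" using assms by simp
  have "2 * a + c \<le> 0" using assms(1)[of 1] by simp
  then have c: "c < 0" using a by linarith
  have "2 * (- a / c) * a + (- a / c)\<^sup>2 * c = - a\<^sup>2 / c"
    using c by (simp add: power2_eq_square field_simps)
  moreover have "- a\<^sup>2 / c > 0" using a c by (simp add: field_simps)
  ultimately show False using assms(1)[of "- a / c"] by linarith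
qed

text \<open>By induction on the number of eigenvectors.  The orthogonal complement \<open>W\<close> of those already found is
invariant under \<open>P\<close>, because \<open>P\<close> is Hermitian, and nonzero, because there are fewer than \<open>n\<close> of
them.  A maximizer of the quadratic form of \<open>P\<close> on the unit sphere of \<open>W\<close> is the next one.\<close>

lemma hermitian_orthonormal_eigenvectors:
  fixes P :: "complex^'n^'n" and I :: "'n set"
  assumes P: "ctranspose P = P"
  shows "\<exists>v d. (\<forall>i\<in>I. \<forall>j\<in>I. cinner (v i) (v j) = (if i = j then 1 else 0))
           \<and> (\<forall>i\<in>I. P *v v i = of_real (d i) *s v i)"
proof (induction I rule: finite_induct[OF finite])
  case 1
  show ?case by simp
next
  case (2 j I)
  obtain v :: "'n \<Rightarrow> complex^'n" and d :: "'n \<Rightarrow> real"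
    where ortho: "\<And>i j. i \<in> I \<Longrightarrow> j \<in> I \<Longrightarrow> cinner (v i) (v j) = (if i = j then 1 else 0)"
      and eig: "\<And>i. i \<in> I \<Longrightarrow> P *v v i = of_real (d i) *s v i"
    using 2 by blast
  define W where "W = {w. \<forall>i\<in>I. cinner (v i) w = 0}"
  have W_add: "x + y \<in> W" if "x \<in> W" "y \<in> W" for x y
    using that by (simp add: W_def cinner_right_add)
  have W_scale: "t *\<^sub>R x \<in> W" if "x \<in> W" for x t
    using that by (simp add: W_def cinner_right_scaleR)
  have W_P: "P *v x \<in> W" if "x \<in> W" for x
  proof -
    have "cinner (v i) (P *v x) = 0" if "i \<in> I" for i
    proof -
      have "cinner (v i) (P *v x) = cinner (P *v v i) x"
        by (simp add: cinner_matrix P)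
      also have "\<dots> = cnj (cinner x (of_real (d i) *s v i))"
        using that by (simp add: eig cinner_commute[of x])
      also have "\<dots> = of_real (d i) * cinner (v i) x"
        by (simp add: cinner_right_scale cinner_commute[of x])
      finally show ?thesis using that \<open>x \<in> W\<close> by (simp add: W_def)
    qed
    then show ?thesis by (simp add: W_def)
  qed
  obtain x where x: "x \<in> W" "x \<noteq> 0"
  proof -
    \<comment> \<open>as \<open>j \<notin> I\<close>, the equations defining \<open>W\<close> form a square system with a zero row\<close>
    define N :: "complex^'n^'n" where "N = (\<chi> i a. if i \<in> I then cnj (v i $ a) else 0)"
    have "row j N = 0" using 2 by (simp add: N_def row_def vec_eq_iff)
    then have "det N = 0" by (rule det_zero_row)
    then have "\<not> (\<exists>B. B ** N = mat 1)"
      by (metis invertible_det_nz invertible_left_inverse)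
    then obtain x where x: "N *v x = 0" "x \<noteq> 0"
      by (auto simp: matrix_left_invertible_ker)
    have "cinner (v i) x = (N *v x) $ i" if "i \<in> I" for i
      using that by (simp add: N_def cinner_def matrix_vector_mult_def)
    then show thesis using that[of x] x by (simp add: W_def)
  qed
  \<comment> \<open>the next eigenvector maximizes the quadratic form of \<open>P\<close> on the unit sphere of \<open>W\<close>\<close>
  define f where "f w = w \<bullet> (P *v w)" for w
  let ?S = "W \<inter> sphere 0 1"
  have "closed W"
    unfolding W_def Collect_ball_eq
    by (intro closed_INT ballI closed_Collect_eq continuous_on_cinner continuous_on_const)
  then have "compact ?S" by (simp add: closed_Int_compact)
  moreover have "(1 / norm x) *\<^sub>R x \<in> ?S" using x W_scale by simp
  moreover have "continuous_on ?S f"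
    unfolding f_def matrix_vector_mult_def by (intro continuous_intros)
  ultimately obtain u where u: "u \<in> W" "norm u = 1" and max: "\<And>w. w \<in> ?S \<Longrightarrow> f w \<le> f u"
    using continuous_attains_sup[of ?S f] by fastforce
  define l where "l = f u"
  have f_le: "f w \<le> l * (w \<bullet> w)" if "w \<in> W" for w
  proof (cases "w = 0")
    case True
    then show ?thesis by (simp add: f_def)
  next
    case False
    have "f ((1 / norm w) *\<^sub>R w) \<le> l"
      unfolding l_def using that False by (intro max) (simp add: W_scale)
    moreover have "f ((1 / norm w) *\<^sub>R w) = f w / (w \<bullet> w)"
      by (simp add: f_def matrix_vector_mult_scaleR_complex power2_eq_square flip: power2_norm_eq_inner)
    ultimately show ?thesis using False by (simp add: divide_le_eq)
  qed
  have sym: "x \<bullet> (P *v y) = y \<bullet> (P *v x)" for x y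
    using cinner_matrix[of P x y] inner_commute[of y "P *v x"] by (simp add: P inner_eq_cinner)
  \<comment> \<open>the residual is in \<open>W\<close>, and the first-order condition in its own direction makes it vanish\<close>
  define w where "w = P *v u + (- l) *\<^sub>R u"
  have w: "w \<in> W" unfolding w_def by (intro W_add W_scale W_P u)
  have "w \<bullet> w = 0"
  proof (rule quadratic_nonpos_imp_linear_zero)
    fix t :: real
    have "f (u + t *\<^sub>R w) \<le> l * ((u + t *\<^sub>R w) \<bullet> (u + t *\<^sub>R w))"
      by (intro f_le W_add W_scale u w)
    moreover have "f (u + t *\<^sub>R w) = l + 2 * t * (w \<bullet> (P *v u)) + t\<^sup>2 * f w"
      using sym[of u w]
      by (simp add: f_def l_def matrix_vector_right_distrib matrix_vector_mult_scaleR_complex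
          inner_add_left inner_add_right power2_eq_square algebra_simps)
    moreover have "(u + t *\<^sub>R w) \<bullet> (u + t *\<^sub>R w) = 1 + 2 * t * (w \<bullet> u) + t\<^sup>2 * (w \<bullet> w)"
      using u inner_commute[of u w] power2_norm_eq_inner[of u]
      by (simp add: inner_add_left inner_add_right power2_eq_square algebra_simps)
    moreover have "w \<bullet> (P *v u) = w \<bullet> w + l * (w \<bullet> u)"
    proof -
      have "P *v u = w + l *\<^sub>R u" by (simp add: w_def)
      then show ?thesis by (simp add: inner_add_right)
    qed
    ultimately have "l + 2 * t * (w \<bullet> w + l * (w \<bullet> u)) + t\<^sup>2 * f w
        \<le> l * (1 + 2 * t * (w \<bullet> u) + t\<^sup>2 * (w \<bullet> w))"
      by (simp only:)
    then show "2 * t * (w \<bullet> w) + t\<^sup>2 * (f w - l * (w \<bullet> w)) \<le> 0"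
      by (simp add: algebra_simps)
  qed simp
  then have Pu: "P *v u = of_real l *s u"
    by (simp add: w_def vec_eq_iff) (simp add: scaleR_conv_of_real add_eq_0_iff)
  have uu: "cinner u u = 1" using u by (simp add: cinner_self)
  have vu: "cinner (v i) u = 0" "cinner u (v i) = 0" if "i \<in> I" for i
    using u that cinner_commute[of u "v i"] by (auto simp: W_def)
  show ?case
    using ortho eig 2 uu vu Pu
    by (intro exI[of _ "v(j := u)"] exI[of _ "d(j := l)"]) auto
qed

definition diag :: "('n \<Rightarrow> complex) \<Rightarrow> complex^'n^'n"
  where "diag e = (\<chi> i j. if i = j then e i else 0)"

lemma diag_mult_left: "(diag e ** A) $ i $ j = e i * A $ i $ j"
  by (simp add: diag_def matrix_matrix_mult_def if_distrib[of "\<lambda>x. x * _"] cong: if_cong)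

lemma diag_mult_right: "(A ** diag e) $ i $ j = A $ i $ j * e j"
  by (simp add: diag_def matrix_matrix_mult_def if_distrib cong: if_cong)

lemma diag_mult: "diag e ** diag f = diag (\<lambda>i. e i * f i)"
  by (simp add: vec_eq_iff diag_mult_left) (simp add: diag_def)

theorem hermitian_diagonalization:
  fixes P :: "complex^'n^'n"
  assumes P: "ctranspose P = P"
  obtains V :: "complex^'n^'n" and d :: "'n \<Rightarrow> real" where "ctranspose V ** V = mat 1"
    and "P = V ** diag (\<lambda>i. of_real (d i)) ** ctranspose V"
proof -
  obtain v :: "'n \<Rightarrow> complex^'n" and d :: "'n \<Rightarrow> real"
    where ortho: "\<And>i j. cinner (v i) (v j) = (if i = j then 1 else 0)"
      and eig: "\<And>i. P *v v i = of_real (d i) *s v i"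
    using hermitian_orthonormal_eigenvectors[OF P, of UNIV] by (metis UNIV_I)
  define V :: "complex^'n^'n" where "V = (\<chi> a i. v i $ a)"
  have V: "ctranspose V ** V = mat 1"
    using ortho by (simp add: vec_eq_iff matrix_matrix_mult_def transpose_def V_def mat_def cinner_def)
  then have V': "V ** ctranspose V = mat 1" using matrix_left_right_inverse by blast
  have "P ** V = V ** diag (\<lambda>i. of_real (d i))"
    using eig by (simp add: vec_eq_iff diag_mult_right)
      (simp add: V_def matrix_matrix_mult_def matrix_vector_mult_def mult.commute)
  then have "P ** (V ** ctranspose V) = V ** diag (\<lambda>i. of_real (d i)) ** ctranspose V"
    by (simp add: matrix_mul_assoc)
  then show thesis using that V by (simp add: V')
qed


lemma U_compact_iff: "M \<in> U_compact \<longleftrightarrow> ctranspose M ** M = mat 1"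
  by (simp add: U_compact_def)

lemma U_compact_iff': "M \<in> U_compact \<longleftrightarrow> M ** ctranspose M = mat 1"
  unfolding U_compact_iff using matrix_left_right_inverse by blast

lemma matrix_inv_unitary: "M \<in> U_compact \<Longrightarrow> matrix_inv M = ctranspose M"
  by (rule matrix_inv_eqI) (simp add: U_compact_iff')

lemma unitary_mult: "M \<in> U_compact \<Longrightarrow> N \<in> U_compact \<Longrightarrow> M ** N \<in> U_compact"
proof -
  assume "M \<in> U_compact" "N \<in> U_compact"
  then have "ctranspose N ** (ctranspose M ** M) ** N = mat 1"
    by (simp add: U_compact_iff)
  then show "M ** N \<in> U_compact"
    by (simp add: U_compact_iff ctranspose_mult matrix_mul_assoc)
qed

lemma unitary_one: "mat 1 \<in> U_compact"
  by (simp only: U_compact_iff ctranspose_mat_1 matrix_mul_lid)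

lemma unitary_matrix_inv: "M \<in> U_compact \<Longrightarrow> matrix_inv M \<in> U_compact"
  by (simp add: matrix_inv_unitary) (simp only: U_compact_iff'[of "ctranspose M"] ctranspose_ctranspose flip: U_compact_iff)

lemma unitary_entry_le:
  fixes M :: "'n::finite cmatrix"
  assumes "M \<in> U_compact"
  shows "cmod (M $ i $ j) \<le> 1"
proof -
  have "(ctranspose M ** M) $ j $ j = 1" using assms by (simp add: U_compact_iff mat_def)
  then have "(\<Sum>a\<in>UNIV. cnj (M $ a $ j) * M $ a $ j) = 1"
    by (simp add: matrix_matrix_mult_def transpose_def)
  then have "of_real (\<Sum>a\<in>UNIV. (cmod (M $ a $ j))\<^sup>2) = (1 :: complex)"
    by (simp add: complex_norm_square mult.commute del: of_real_power)
  then have "(\<Sum>a\<in>UNIV. (cmod (M $ a $ j))\<^sup>2) = 1" by (simp only: of_real_eq_1_iff)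
  then have "(cmod (M $ i $ j))\<^sup>2 \<le> 1"
    using member_le_sum[of i UNIV "\<lambda>a. (cmod (M $ a $ j))\<^sup>2"] by simp
  then show ?thesis by (simp add: power_le_one_iff abs_square_le_1)
qed

lemma compact_U_compact: "compact (U_compact :: 'n::finite cmatrix set)"
proof -
  have "bounded (U_compact :: 'n::finite cmatrix set)"
  proof (rule boundedI)
    fix M :: "'n::finite cmatrix" assume M: "M \<in> U_compact"
    have "norm M \<le> (\<Sum>i\<in>UNIV. norm (M $ i))" unfolding norm_vec_def by (rule L2_set_le_sum) simp
    also have "\<dots> \<le> (\<Sum>i\<in>UNIV. \<Sum>j\<in>UNIV. norm (M $ i $ j))"
      by (intro sum_mono) (metis norm_vec_def L2_set_le_sum norm_ge_zero)
    also have "\<dots> \<le> (\<Sum>i\<in>(UNIV::'n set). \<Sum>j\<in>(UNIV::'n set). 1)"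
      by (intro sum_mono unitary_entry_le M)
    finally show "norm M \<le> (\<Sum>i\<in>(UNIV::'n set). \<Sum>j\<in>(UNIV::'n set). 1)" .
  qed
  moreover have "closed (U_compact :: 'n::finite cmatrix set)"
    unfolding U_compact_def
    by (intro closed_Collect_eq continuous_intros)
      (simp_all add: matrix_matrix_mult_def transpose_def, intro continuous_intros)
  ultimately show ?thesis by (simp add: compact_eq_bounded_closed)
qed

text \<open>For \<open>V\<close> unitary and \<open>d > 0\<close> this is \<open>P\<^bsup>z\<^esup>\<close>, where \<open>P = V diag(d) V\<^sup>*\<close> is positive definite.\<close>

definition hermitian_power :: "complex^'n^'n \<Rightarrow> ('n \<Rightarrow> real) \<Rightarrow> complex \<Rightarrow> complex^'n^'n"
  where "hermitian_power V d z = V ** diag (\<lambda>i. exp (z * of_real (ln (d i)))) ** ctranspose V"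

lemma hermitian_power_add:
  assumes "V \<in> U_compact"
  shows "hermitian_power V d w ** hermitian_power V d z = hermitian_power V d (w + z)"
proof -
  let ?D = "\<lambda>z. diag (\<lambda>i. exp (z * of_real (ln (d i))))"
  have "hermitian_power V d w ** hermitian_power V d z = V ** ?D w ** (ctranspose V ** V) ** ?D z ** ctranspose V"
    by (simp only: hermitian_power_def matrix_mul_assoc)
  also have "\<dots> = V ** (?D w ** ?D z) ** ctranspose V"
    using assms by (simp add: U_compact_iff matrix_mul_assoc)
  finally show ?thesis
    by (simp add: diag_mult hermitian_power_def exp_add distrib_right)
qed

lemma hermitian_power_0:
  assumes "V \<in> U_compact"
  shows "hermitian_power V d 0 = mat 1"
proof -
  have "diag (\<lambda>_. 1) = (mat 1 :: complex^'a^'a)" by (simp add: diag_def mat_def)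
  then show ?thesis using assms by (simp add: hermitian_power_def U_compact_iff')
qed

lemma hermitian_power_1:
  assumes "\<And>i. d i > 0"
  shows "hermitian_power V d 1 = V ** diag (\<lambda>i. of_real (d i)) ** ctranspose V"
  using assms by (simp add: hermitian_power_def exp_of_real)

lemma ctranspose_hermitian_power: "ctranspose (hermitian_power V d z) = hermitian_power V d (cnj z)"
proof -
  have "ctranspose (diag (\<lambda>i. exp (z * of_real (ln (d i))))) = diag (\<lambda>i. exp (cnj z * of_real (ln (d i))))"
    by (simp add: vec_eq_iff diag_def transpose_def exp_cnj)
  then show ?thesis
    by (simp add: hermitian_power_def ctranspose_mult ctranspose_ctranspose matrix_mul_assoc)
qed

lemma holomorphic_hermitian_power: "(\<lambda>z. hermitian_power V d z $ i $ j) holomorphic_on A"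
  by (simp add: hermitian_power_def matrix_matrix_mult_def[of "V ** _"] diag_mult_right)
    (intro holomorphic_intros)

text \<open>For an eigenvector \<open>v\<close> of \<open>g\<^sup>* g\<close> of norm one the eigenvalue is the square of the norm of \<open>g v\<close>, so it
is positive.\<close>

lemma positive_diagonalization:
  fixes g :: "complex^'n^'n"
  assumes g: "invertible g"
  obtains V d where "V \<in> U_compact" "\<And>i. d i > 0" "ctranspose g ** g = hermitian_power V d 1"
proof -
  let ?P = "ctranspose g ** g"
  obtain V :: "complex^'n^'n" and d :: "'n \<Rightarrow> real" where V: "ctranspose V ** V = mat 1"
    and P: "?P = V ** diag (\<lambda>i. of_real (d i)) ** ctranspose V"
    using hermitian_diagonalization[of ?P] by (metis ctranspose_mult ctranspose_ctranspose)
  have "d i > 0" for i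
  proof -
    define v where "v = column i V"
    have "cinner v v = (ctranspose V ** V) $ i $ i"
      by (simp add: v_def cinner_def matrix_matrix_mult_def transpose_def column_def)
    then have vv: "cinner v v = 1" using V by (simp add: mat_def)
    have "?P ** V = V ** diag (\<lambda>i. of_real (d i)) ** (ctranspose V ** V)"
      by (simp only: P matrix_mul_assoc)
    then have PV: "?P ** V = V ** diag (\<lambda>i. of_real (d i))" by (simp add: V)
    have "?P *v v = of_real (d i) *s v"
    proof -
      have "(?P *v v) $ a = (?P ** V) $ a $ i" for a
        by (simp add: matrix_vector_mult_def v_def column_def) (simp add: matrix_matrix_mult_def)
      then show ?thesis
        by (simp add: vec_eq_iff PV diag_mult_right) (simp add: v_def column_def)
    qed
    moreover have "cinner v (?P *v v) = cinner (g *v v) (g *v v)"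
      by (simp add: cinner_matrix[of g] matrix_vector_mul_assoc)
    ultimately have "of_real (d i) = cinner (g *v v) (g *v v)"
      by (simp add: cinner_right_scale vv)
    then have di: "d i = (norm (g *v v))\<^sup>2"
      by (simp only: cinner_self of_real_eq_iff)
    have "g *v v \<noteq> 0"
    proof
      assume "g *v v = 0"
      then have "v = 0"
        using g matrix_left_invertible_ker[of g] by (auto simp: invertible_def)
      then show False using vv by (simp add: cinner_def)
    qed
    then show ?thesis by (simp add: di)
  qed
  then show thesis using that[of V d] V P by (simp add: U_compact_iff hermitian_power_1)
qed


section \<open>Groups closed under complex powers of their positive elements\<close>

text \<open>The properties of \<open>G\<close> on which the proof rests.  The last one says that \<open>G\<close> is stable under polar
decomposition and that the positive factor extends to a complex one-parameter subgroup of \<open>G\<close>.  It is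
stated for every diagonalization of \<open>g\<^sup>* g\<close>, which makes the class of these groups closed under
intersection.\<close>

locale polar_group =
  fixes G :: "'m::finite cmatrix set"
  assumes one_closed: "mat 1 \<in> G"
    and mult_closed: "g \<in> G \<Longrightarrow> h \<in> G \<Longrightarrow> g ** h \<in> G"
    and inv_closed: "g \<in> G \<Longrightarrow> matrix_inv g \<in> G"
    and invertible: "g \<in> G \<Longrightarrow> invertible g"
    and closed_unitary: "closed (G \<inter> U_compact)"
    and power_closed: "g \<in> G \<Longrightarrow> V \<in> U_compact \<Longrightarrow> (\<And>i. d i > 0)
      \<Longrightarrow> ctranspose g ** g = hermitian_power V d 1 \<Longrightarrow> hermitian_power V d z \<in> G"
begin

lemma compact_unitary: "compact (G \<inter> U_compact)"
  using compact_Int_closed[OF compact_U_compact closed_unitary] by (simp add: Int_ac)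

text \<open>The curve is \<open>z \<mapsto> g P\<^bsup>(z - 1)/2\<^esup>\<close> with \<open>P = g\<^sup>* g\<close>.  At \<open>z = 0\<close> it is the unitary factor of the polar
decomposition of \<open>g\<close>, and from there the imaginary direction is unitary.\<close>

lemma complex_curve:
  assumes g: "g \<in> G"
  obtains c where "c 1 = g" "\<And>z. c z \<in> G" "\<And>z. Re z = 0 \<Longrightarrow> c z \<in> U_compact"
    "\<And>i j. (\<lambda>z. c z $ i $ j) holomorphic_on UNIV"
    "\<And>i j. (\<lambda>z. matrix_inv (c z) $ i $ j) holomorphic_on UNIV"
proof -
  obtain V d where V: "V \<in> U_compact" and d: "\<And>i. d i > 0"
    and P: "ctranspose g ** g = hermitian_power V d 1"
    using positive_diagonalization[OF invertible[OF g]] by blast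
  define c where "c z = g ** hermitian_power V d ((z - 1) / 2)" for z
  have hG: "hermitian_power V d z \<in> G" for z
    using power_closed[OF g V d P] .
  have "c 1 = g" by (simp add: c_def hermitian_power_0 V)
  moreover have "c z \<in> G" for z by (simp add: c_def mult_closed g hG)
  moreover have "c z \<in> U_compact" if "Re z = 0" for z
  proof -
    have "ctranspose (c z) ** c z
        = hermitian_power V d (cnj ((z - 1) / 2)) ** (ctranspose g ** g) ** hermitian_power V d ((z - 1) / 2)"
      by (simp only: c_def ctranspose_mult ctranspose_hermitian_power matrix_mul_assoc)
    also have "\<dots> = hermitian_power V d (cnj ((z - 1) / 2) + 1 + (z - 1) / 2)"
      by (simp only: P hermitian_power_add[OF V])
    also have "cnj ((z - 1) / 2) + 1 + (z - 1) / 2 = 0"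
      using that by (simp add: complex_eq_iff)
    finally show ?thesis by (simp add: U_compact_iff hermitian_power_0[OF V])
  qed
  moreover have "(\<lambda>z. hermitian_power V d (f z) $ i $ j) holomorphic_on UNIV"
    if "f holomorphic_on UNIV" for f i j
    using holomorphic_on_compose[OF that holomorphic_hermitian_power, of V d i j]
    by (simp add: o_def)
  note hol = this
  have "(\<lambda>z. c z $ i $ j) holomorphic_on UNIV" for i j
    by (simp add: c_def matrix_matrix_mult_def) (intro holomorphic_intros hol, auto)
  moreover have "matrix_inv (c z) = hermitian_power V d (- ((z - 1) / 2)) ** matrix_inv g" for z
  proof -
    have "matrix_inv (hermitian_power V d ((z - 1) / 2)) = hermitian_power V d (- ((z - 1) / 2))"
      by (rule matrix_inv_eqI) (simp add: hermitian_power_add V hermitian_power_0)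
    then show ?thesis by (simp add: c_def matrix_inv_mult invertible g hG)
  qed
  then have "(\<lambda>z. matrix_inv (c z) $ i $ j) holomorphic_on UNIV" for i j
    by (simp add: matrix_matrix_mult_def) (intro holomorphic_intros hol, auto)
  ultimately show thesis using that by blast
qed

end

lemma polar_group_Int:
  assumes "polar_group G" "polar_group H"
  shows "polar_group (G \<inter> H)"
proof -
  interpret G: polar_group G by fact
  interpret H: polar_group H by fact
  show ?thesis
  proof
    have "closed ((G \<inter> U_compact) \<inter> (H \<inter> U_compact))"
      by (intro closed_Int G.closed_unitary H.closed_unitary)
    then show "closed (G \<inter> H \<inter> U_compact)" by (simp add: Int_ac)
    show "hermitian_power V d z \<in> G \<inter> H"
      if "g \<in> G \<inter> H" "V \<in> U_compact" "\<And>i. d i > 0" "ctranspose g ** g = hermitian_power V d 1" for g V d z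
      using that G.power_closed[of g V d z] H.power_closed[of g V d z] by blast
  qed (simp_all add: G.one_closed H.one_closed G.mult_closed H.mult_closed G.inv_closed H.inv_closed
      G.invertible)
qed

section \<open>The classical groups and their compact forms\<close>

lemma invertible_hermitian_power: "V \<in> U_compact \<Longrightarrow> invertible (hermitian_power V d z)"
  unfolding invertible_right_inverse
  by (rule exI[of _ "hermitian_power V d (- z)"]) (simp add: hermitian_power_add hermitian_power_0)

lemma invertible_unitary: "M \<in> U_compact \<Longrightarrow> invertible M"
  unfolding invertible_left_inverse using U_compact_iff by blast

lemma invertible_matrix_inv: "invertible (M::'n::finite cmatrix) \<Longrightarrow> invertible (matrix_inv M)"
  unfolding invertible_left_inverse[of "matrix_inv M"] using matrix_inv_right by blast

lemma GL_unitary: "GL \<inter> U_compact = U_compact"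
  by (auto simp: GL_def invertible_unitary)

lemma polar_group_GL: "polar_group (GL :: 'n::finite cmatrix set)"
proof
  show "closed (GL \<inter> U_compact :: 'n::finite cmatrix set)"
    using compact_imp_closed[OF compact_U_compact] by (simp add: GL_unitary)
  show "mat 1 \<in> (GL :: 'n::finite cmatrix set)" unfolding GL_def invertible_left_inverse by auto
qed (simp_all add: GL_def invertible_mult invertible_matrix_inv invertible_hermitian_power)

lemma det_map_cnj: "det (map_matrix cnj A) = cnj (det A)"
  by (simp add: det_def)

lemma det_ctranspose: "det (ctranspose A) = cnj (det A)"
  by (simp add: det_map_cnj det_transpose)

lemma det_hermitian_power:
  assumes "V \<in> U_compact"
  shows "det (hermitian_power V d z) = exp (z * of_real (\<Sum>i\<in>UNIV. ln (d i)))"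
proof -
  have "det V * det (ctranspose V) = 1"
    using assms unfolding U_compact_iff' by (simp flip: det_mul)
  moreover have "det (diag (\<lambda>i. exp (z * of_real (ln (d i))))) = exp (z * of_real (\<Sum>i\<in>UNIV. ln (d i)))"
    by (subst det_diagonal) (simp_all add: diag_def exp_sum sum_distrib_left)
  ultimately show ?thesis by (simp add: hermitian_power_def det_mul mult_ac)
qed

lemma continuous_on_det: "continuous_on S (det :: complex^'n^'n \<Rightarrow> complex)"
  unfolding det_def by (intro continuous_intros)

lemma closed_SL: "closed (SL :: 'n::finite cmatrix set)"
  unfolding SL_def by (intro closed_Collect_eq continuous_on_det continuous_intros)

text \<open>The determinant of \<open>P = g\<^sup>* g\<close> is \<open>1\<close>, so the logarithms of its eigenvalues add up to \<open>0\<close>, and the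
determinant of \<open>P\<^bsup>z\<^esup>\<close> is the exponential of \<open>z\<close> times this sum.\<close>

lemma polar_group_SL: "polar_group (SL :: 'n::finite cmatrix set)"
proof
  fix g h V :: "'n::finite cmatrix" and d :: "'n \<Rightarrow> real" and z
  show "mat 1 \<in> (SL :: 'n::finite cmatrix set)" by (simp add: SL_def)
  show "closed (SL \<inter> U_compact :: 'n::finite cmatrix set)"
    by (intro closed_Int closed_SL compact_imp_closed compact_U_compact)
  assume g: "g \<in> SL"
  then show inv: "invertible g" by (simp add: SL_def invertible_det_nz)
  have "det g * det (matrix_inv g) = 1" using inv by (simp add: matrix_inv_right flip: det_mul)
  then show "matrix_inv g \<in> SL" using g by (simp add: SL_def)
  { assume "h \<in> SL" then show "g ** h \<in> SL" using g by (simp add: SL_def det_mul) }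
  assume V: "V \<in> U_compact" and d: "\<And>i. d i > 0" and P: "ctranspose g ** g = hermitian_power V d 1"
  have "det (hermitian_power V d 1) = 1"
    using g by (simp add: det_mul det_ctranspose SL_def flip: P)
  then have "complex_of_real (exp (\<Sum>i\<in>UNIV. ln (d i))) = 1"
    by (simp only: det_hermitian_power V mult_1 exp_of_real)
  then have "exp (\<Sum>i\<in>UNIV. ln (d i)) = 1" by (simp only: of_real_eq_1_iff)
  then have "(\<Sum>i\<in>UNIV. ln (d i)) = 0" by simp
  then show "hermitian_power V d z \<in> SL" by (simp add: SL_def det_hermitian_power V)
qed

lemma map_cnj_mult: "map_matrix cnj (A ** B) = map_matrix cnj A ** map_matrix cnj B"
  by (simp add: vec_eq_iff matrix_matrix_mult_def)

lemma transpose_map_matrix: "transpose (map_matrix f A) = map_matrix f (transpose A)"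
  by (simp add: vec_eq_iff transpose_def)

text \<open>The orthogonal and symplectic groups are treated together, as the isometries of a bilinear form
with real orthogonal matrix \<open>B\<close>, which is the identity or \<open>J\<close>.\<close>

definition isometries :: "'n::finite cmatrix \<Rightarrow> 'n cmatrix set"
  where "isometries B = {M \<in> GL. transpose M ** B ** M = B}"

lemma isometries_mult:
  assumes "M \<in> isometries B" "N \<in> isometries B"
  shows "M ** N \<in> isometries B"
proof -
  have "transpose (M ** N) ** B ** (M ** N) = transpose N ** (transpose M ** B ** M) ** N"
    by (simp only: matrix_transpose_mul matrix_mul_assoc)
  then show ?thesis using assms by (simp add: isometries_def GL_def invertible_mult)
qed

text \<open>The condition on \<open>M\<close> says that \<open>B\<^sup>T M\<^sup>T B\<close> is a left inverse of \<open>M\<close>.  It is then a right inverse, which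
gives \<open>M B M\<^sup>T = B\<close>, and the claim is the complex conjugate of this.\<close>

lemma isometries_ctranspose:
  assumes B: "map_matrix cnj B = B" "transpose B ** B = mat 1" and M: "M \<in> isometries B"
  shows "ctranspose M \<in> isometries B"
proof -
  have iso: "transpose M ** B ** M = B" and inv: "invertible M" using M by (auto simp: isometries_def GL_def)
  have "(transpose B ** transpose M ** B) ** M = transpose B ** (transpose M ** B ** M)"
    by (simp only: matrix_mul_assoc)
  then have "(transpose B ** transpose M ** B) ** M = mat 1" by (simp add: iso B)
  then have "M ** (transpose B ** transpose M ** B) = mat 1"
    using matrix_left_right_inverse by blast
  then have "M ** transpose B ** transpose M ** B = mat 1" by (simp add: matrix_mul_assoc)
  then have "M ** transpose B ** transpose M ** (B ** transpose B) = transpose B"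
    by (simp add: matrix_mul_assoc)
  moreover have "B ** transpose B = mat 1" using B(2) matrix_left_right_inverse by blast
  ultimately have "transpose (M ** transpose B ** transpose M) = B" by simp
  then have "M ** B ** transpose M = B" by (simp add: matrix_transpose_mul matrix_mul_assoc)
  then have "map_matrix cnj (M ** B ** transpose M) = B" by (simp add: B)
  then have "transpose (ctranspose M) ** B ** ctranspose M = B"
    by (simp add: map_cnj_mult B transpose_map_matrix)
  moreover have "invertible (ctranspose M)"
    using inv by (simp add: invertible_det_nz det_ctranspose)
  ultimately show ?thesis by (simp add: isometries_def GL_def)
qed

text \<open>In the eigenbasis, with \<open>C\<close> the matrix of the form, membership becomes an entrywise condition:
\<open>C\<^sub>i\<^sub>j \<noteq> 0\<close> only where the \<open>z\<close>-th powers of the \<open>i\<close>-th and the \<open>j\<close>-th eigenvalue are inverse to each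
other.\<close>

lemma hermitian_power_isometry_iff:
  assumes V: "V \<in> U_compact"
  shows "hermitian_power V d z \<in> isometries B \<longleftrightarrow>
    (let E = diag (\<lambda>i. exp (z * of_real (ln (d i)))); C = transpose V ** B ** V in E ** C ** E = C)"
proof -
  define E where "E = diag (\<lambda>i. exp (z * of_real (ln (d i))))"
  define C where "C = transpose V ** B ** V"
  have V1: "V ** ctranspose V = mat 1" "ctranspose V ** V = mat 1"
    using V by (simp_all add: U_compact_iff flip: U_compact_iff')
  have V2: "transpose V ** map_matrix cnj V = mat 1" "map_matrix cnj V ** transpose V = mat 1"
    using arg_cong[OF V1(2), of transpose] arg_cong[OF V1(1), of transpose]
    by (simp_all add: matrix_transpose_mul transpose_map_matrix)
  have "transpose E = E" by (simp add: E_def diag_def transpose_def vec_eq_iff)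
  then have "transpose (hermitian_power V d z) ** B ** hermitian_power V d z
      = map_matrix cnj V ** (E ** C ** E) ** ctranspose V"
    by (simp add: hermitian_power_def C_def matrix_transpose_mul transpose_map_matrix matrix_mul_assoc
        flip: E_def)
  moreover have "map_matrix cnj V ** (E ** C ** E) ** ctranspose V = B \<longleftrightarrow> E ** C ** E = C"
  proof
    assume B: "map_matrix cnj V ** (E ** C ** E) ** ctranspose V = B"
    have "transpose V ** (map_matrix cnj V ** (E ** C ** E) ** ctranspose V) ** V
        = (transpose V ** map_matrix cnj V) ** (E ** C ** E) ** (ctranspose V ** V)"
      by (simp only: matrix_mul_assoc)
    then have "transpose V ** B ** V = E ** C ** E"
      by (simp only: B V1 V2 matrix_mul_lid matrix_mul_rid)
    then show "E ** C ** E = C" by (simp only: C_def)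
  next
    assume "E ** C ** E = C"
    then have "map_matrix cnj V ** (E ** C ** E) ** ctranspose V
        = (map_matrix cnj V ** transpose V) ** B ** (V ** ctranspose V)"
      by (simp only: C_def matrix_mul_assoc)
    then show "map_matrix cnj V ** (E ** C ** E) ** ctranspose V = B" by (simp add: V1 V2)
  qed
  ultimately show ?thesis
    by (simp add: isometries_def GL_def invertible_hermitian_power V Let_def flip: E_def C_def)
qed

text \<open>If \<open>d\<^sub>i d\<^sub>j = 1\<close> for positive \<open>d\<^sub>i\<close> and \<open>d\<^sub>j\<close> then their \<open>z\<close>-th powers are inverse to each other too.  So
the entrywise condition for \<open>P = g\<^sup>* g\<close> implies the one for \<open>P\<^bsup>z\<^esup>\<close>.\<close>

lemma polar_group_isometries:
  fixes B :: "'n::finite cmatrix"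
  assumes B: "map_matrix cnj B = B" "transpose B ** B = mat 1"
  shows "polar_group (isometries B)"
proof
  fix g h V :: "'n::finite cmatrix" and d :: "'n \<Rightarrow> real" and z
  show "mat 1 \<in> isometries B"
    using polar_group.one_closed[OF polar_group_GL] by (simp add: isometries_def)
  have "isometries B \<inter> U_compact = {M. transpose M ** B ** M = B} \<inter> U_compact"
    using GL_unitary by (auto simp: isometries_def)
  moreover have "closed {M. transpose M ** B ** M = B}"
    by (intro closed_Collect_eq continuous_intros)
      (simp_all add: matrix_matrix_mult_def transpose_def, intro continuous_intros)
  ultimately show "closed (isometries B \<inter> U_compact)"
    by (simp add: closed_Int compact_imp_closed compact_U_compact)
  assume g: "g \<in> isometries B"
  { assume "h \<in> isometries B" with g show "g ** h \<in> isometries B" by (rule isometries_mult) }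
  show inv: "invertible g" using g by (simp add: isometries_def GL_def)
  have "transpose (matrix_inv g) ** (transpose g ** B ** g) ** matrix_inv g
      = transpose (g ** matrix_inv g) ** B ** (g ** matrix_inv g)"
    by (simp only: matrix_transpose_mul matrix_mul_assoc)
  then show "matrix_inv g \<in> isometries B"
    using g by (simp add: isometries_def GL_def matrix_inv_right invertible_matrix_inv)
  assume V: "V \<in> U_compact" and d: "\<And>i. d i > 0" and P: "ctranspose g ** g = hermitian_power V d 1"
  define C where "C = transpose V ** B ** V"
  have "hermitian_power V d 1 \<in> isometries B"
    unfolding P[symmetric] by (intro isometries_mult isometries_ctranspose B g)
  moreover have "(\<lambda>i. exp (1 * complex_of_real (ln (d i)))) = (\<lambda>i. of_real (d i))"
    using d by (simp add: exp_of_real)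
  ultimately have "diag (\<lambda>i. of_real (d i)) ** C ** diag (\<lambda>i. of_real (d i)) = C"
    using hermitian_power_isometry_iff[OF V, of d 1 B] by (simp only: C_def Let_def)
  then have "(diag (\<lambda>i. of_real (d i)) ** C ** diag (\<lambda>i. of_real (d i))) $ i $ j = C $ i $ j" for i j
    by simp
  then have dC: "of_real (d i) * C $ i $ j * of_real (d j) = C $ i $ j" for i j
    by (simp add: diag_mult_left diag_mult_right)
  have "exp (z * of_real (ln (d i))) * C $ i $ j * exp (z * of_real (ln (d j))) = C $ i $ j" for i j
  proof (cases "C $ i $ j = 0")
    case False
    have "of_real (d i * d j) * C $ i $ j = 1 * C $ i $ j" using dC[of i j] by (simp add: mult_ac)
    then have "d i * d j = 1" using False by (metis mult_right_cancel of_real_eq_1_iff)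
    then have "ln (d i) + ln (d j) = 0" using d[of i] d[of j] by (simp flip: ln_mult_pos)
    then have "exp (z * of_real (ln (d i))) * exp (z * of_real (ln (d j))) = 1"
      by (simp flip: exp_add distrib_left of_real_add)
    then show ?thesis by (metis mult.assoc mult.commute mult_1)
  qed simp
  then show "hermitian_power V d z \<in> isometries B"
    by (simp add: hermitian_power_isometry_iff V vec_eq_iff diag_mult_left diag_mult_right flip: C_def)
qed

lemma O_complex_eq: "O_complex = isometries (mat 1)"
  by (simp add: O_complex_def isometries_def)

lemma polar_group_O: "polar_group O_complex"
  unfolding O_complex_eq
proof (rule polar_group_isometries)
  show "map_matrix cnj (mat 1) = mat 1" by (simp add: vec_eq_iff mat_def)
qed (simp add: transpose_mat)

lemma Sp_complex_eq: "Sp_complex = SL \<inter> isometries J"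
  by (auto simp: Sp_complex_def isometries_def GL_def SL_def invertible_det_nz)

lemma polar_group_Sp: "polar_group (Sp_complex :: ('n::finite + 'n) cmatrix set)"
  unfolding Sp_complex_eq
proof (intro polar_group_Int polar_group_SL polar_group_isometries)
  show "map_matrix cnj J = J"
    by (simp add: vec_eq_iff J_def split: sum.split)
  show "transpose J ** J = (mat 1 :: ('n::finite + 'n) cmatrix)"
  proof -
    have sum: "sum f UNIV = (\<Sum>i\<in>UNIV. f (Inl i)) + (\<Sum>i\<in>UNIV. f (Inr i))" for f :: "'n + 'n \<Rightarrow> complex"
      by (simp add: sum.Plus comp_def flip: UNIV_Plus_UNIV)
    have "(transpose J ** J) $ a $ b = (mat 1 :: ('n + 'n) cmatrix) $ a $ b" for a b
      unfolding matrix_matrix_mult_def transpose_def mat_def sum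
      by (cases a; cases b) (auto simp: J_def sum if_distrib[of "\<lambda>x. x * _"] cong: if_cong)
    then show ?thesis by (simp add: vec_eq_iff)
  qed
qed

lemma det_map_of_real: "det (map_matrix complex_of_real A) = of_real (det A)"
  by (simp add: det_def)

text \<open>A unitary matrix with \<open>M\<^sup>T M = 1\<close> has \<open>M\<^sup>T = M\<^bsup>-1\<^esup> = M\<^sup>*\<close>, so its entries are real.\<close>

lemma O_compact_eq: "(O_compact :: 'n::finite cmatrix set) = O_complex \<inter> U_compact"
proof (intro subset_antisym subsetI)
  fix M :: "'n::finite cmatrix"
  assume "M \<in> O_compact"
  then obtain A where M: "M = map_matrix complex_of_real A" and A: "transpose A ** A = mat 1"
    by (auto simp: O_compact_def orthogonal_matrix_def)
  have "map_matrix complex_of_real (transpose A ** A) = transpose M ** M"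
    by (simp add: M vec_eq_iff matrix_matrix_mult_def transpose_def)
  moreover have "map_matrix complex_of_real (mat 1) = (mat 1 :: 'n cmatrix)" by (simp add: vec_eq_iff mat_def)
  ultimately have MM: "transpose M ** M = mat 1" by (simp add: A)
  moreover have "ctranspose M = transpose M" by (simp add: M vec_eq_iff transpose_def)
  moreover have "invertible M" using MM invertible_left_inverse by blast
  ultimately show "M \<in> O_complex \<inter> U_compact"
    by (simp add: O_complex_def U_compact_iff GL_def)
next
  fix M :: "'n::finite cmatrix"
  assume "M \<in> O_complex \<inter> U_compact"
  then have MM: "transpose M ** M = mat 1" "M ** ctranspose M = mat 1"
    by (auto simp: O_complex_def simp flip: U_compact_iff')
  have "transpose M ** (M ** ctranspose M) = (transpose M ** M) ** ctranspose M"
    by (simp only: matrix_mul_assoc)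
  then have "transpose M = ctranspose M" by (simp add: MM)
  then have "cnj (M $ i $ j) = M $ i $ j" for i j
    by (simp add: vec_eq_iff transpose_def)
  then have real: "M = map_matrix complex_of_real (map_matrix Re M)"
    by (simp add: vec_eq_iff complex_eq_iff)
  define A where "A = map_matrix Re M"
  have "map_matrix complex_of_real (transpose A ** A) = transpose M ** M"
    by (subst (1 2) real) (simp add: A_def vec_eq_iff matrix_matrix_mult_def transpose_def)
  then have "transpose A ** A = mat 1"
    by (simp add: MM) (simp add: vec_eq_iff mat_def of_real_eq_iff[where 'a=complex, symmetric] del: of_real_eq_iff)
  then have "orthogonal_matrix A" by (simp add: orthogonal_matrix)
  then show "M \<in> O_compact" using real by (auto simp: O_compact_def A_def)
qed

lemma SO_compact_eq: "SO_compact = SO_complex \<inter> U_compact"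
proof -
  have "SO_compact = O_compact \<inter> SL"
    by (auto simp: SO_compact_def O_compact_def SL_def det_map_of_real)
  then show ?thesis by (auto simp: O_compact_eq SO_complex_def)
qed

section \<open>Regular functions on tuples of matrices\<close>

lemma algebra_on_restrict: "p \<in> algebra_on X F \<Longrightarrow> restrict p X = p"
  by (induction rule: algebra_on.induct) auto

lemma algebra_on_add:
  assumes "restrict f X \<in> algebra_on X F" "restrict g X \<in> algebra_on X F"
  shows "restrict (\<lambda>x. f x + g x) X \<in> algebra_on X F"
  using algebra_on.add[OF assms] by (simp cong: restrict_cong)

lemma algebra_on_mult:
  assumes "restrict f X \<in> algebra_on X F" "restrict g X \<in> algebra_on X F"
  shows "restrict (\<lambda>x. f x * g x) X \<in> algebra_on X F"
  using algebra_on.mult[OF assms] by (simp cong: restrict_cong)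

lemma algebra_on_scale:
  assumes "restrict f X \<in> algebra_on X F"
  shows "restrict (\<lambda>x. c * f x) X \<in> algebra_on X F"
  by (intro algebra_on_mult assms algebra_on.const)

lemma algebra_on_sum:
  assumes "\<And>i. i \<in> I \<Longrightarrow> restrict (f i) X \<in> algebra_on X F"
  shows "restrict (\<lambda>x. \<Sum>i\<in>I. f i x) X \<in> algebra_on X F"
  using assms
  by (induction I rule: infinite_finite_induct) (simp_all add: algebra_on.const algebra_on_add)

lemma algebra_on_prod:
  assumes "\<And>i. i \<in> I \<Longrightarrow> restrict (f i) X \<in> algebra_on X F"
  shows "restrict (\<lambda>x. \<Prod>i\<in>I. f i x) X \<in> algebra_on X F"
  using assms
  by (induction I rule: infinite_finite_induct) (simp_all add: algebra_on.const algebra_on_mult)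

lemma algebra_on_det:
  fixes M :: "'x \<Rightarrow> complex^'n^'n"
  assumes "\<And>a b. restrict (\<lambda>x. M x $ a $ b) X \<in> algebra_on X F"
  shows "restrict (\<lambda>x. det (M x)) X \<in> algebra_on X F"
  unfolding det_def by (intro algebra_on_sum algebra_on_scale algebra_on_prod assms)

lemma algebra_on_eqI:
  assumes "p \<in> algebra_on X F" "x \<in> X" "y \<in> X" "\<And>f. f \<in> F \<Longrightarrow> f x = f y"
  shows "p x = p y"
  using assms(1) by induction (use assms in auto)

lemma entry_regular:
  "i < s \<Longrightarrow> restrict (\<lambda>A. A i $ a $ b) H \<in> regular_functions s H"
  unfolding regular_functions_def coordinate_functions_def by (intro algebra_on.gen) blast

lemma inverse_det_regular:
  "i < s \<Longrightarrow> restrict (\<lambda>A. inverse (det (A i))) H \<in> regular_functions s H"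
  unfolding regular_functions_def coordinate_functions_def by (intro algebra_on.gen) blast

lemma regular_functions_induct [consumes 1, case_names entry inverse_det const add mult]:
  assumes "p \<in> regular_functions s H"
    and "\<And>i a b. i < s \<Longrightarrow> P (restrict (\<lambda>A. A i $ a $ b) H)"
    and "\<And>i. i < s \<Longrightarrow> P (restrict (\<lambda>A. inverse (det (A i))) H)"
    and "\<And>c. P (restrict (\<lambda>_. c) H)"
    and "\<And>p q. p \<in> regular_functions s H \<Longrightarrow> q \<in> regular_functions s H \<Longrightarrow> P p \<Longrightarrow> P q
      \<Longrightarrow> P (restrict (\<lambda>x. p x + q x) H)"
    and "\<And>p q. p \<in> regular_functions s H \<Longrightarrow> q \<in> regular_functions s H \<Longrightarrow> P p \<Longrightarrow> P q
      \<Longrightarrow> P (restrict (\<lambda>x. p x * q x) H)"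
  shows "P p"
  using assms(1) unfolding regular_functions_def
proof induction
  case (gen f)
  then show ?case using assms(2,3) by (auto simp: coordinate_functions_def simp del: restrict_apply)
qed (use assms(4-6) in \<open>auto simp: regular_functions_def simp del: restrict_apply\<close>)

text \<open>Cramer's rule for the columns of the inverse.\<close>

lemma matrix_inv_entry:
  fixes M :: "complex^'n^'n"
  assumes "invertible M"
  shows "matrix_inv M $ a $ b
    = det (\<chi> i j. if j = a then (if i = b then 1 else 0) else M $ i $ j) * inverse (det M)"
proof -
  let ?x = "column b (matrix_inv M)"
  have "M *v ?x = column b (M ** matrix_inv M)"
    by (simp add: vec_eq_iff column_def matrix_vector_mult_def matrix_matrix_mult_def)
  also have "\<dots> = (\<chi> i. if i = b then 1 else 0)"
    using assms by (simp add: matrix_inv_right column_def mat_def)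
  finally have Mx: "M *v ?x = (\<chi> i. if i = b then 1 else 0)" .
  have "det M \<noteq> 0" using assms by (simp add: invertible_det_nz)
  note iffD1[OF cramer[OF this] Mx]
  then have "?x $ a = (\<chi> k. det (\<chi> i j. if j = k then (\<chi> i. if i = b then 1 else 0) $ i else M $ i $ j) / det M) $ a"
    by (rule arg_cong)
  then show ?thesis by (simp add: column_def divide_inverse cong: if_cong)
qed

lemma inverse_entry_regular:
  assumes i: "i < s" and inv: "\<And>A. A \<in> H \<Longrightarrow> invertible (A i)"
  shows "restrict (\<lambda>A. matrix_inv (A i) $ a $ b) H \<in> regular_functions s H"
proof -
  have "restrict (\<lambda>A. det (\<chi> r c. if c = a then (if r = b then 1 else 0) else A i $ r $ c)
          * inverse (det (A i))) H \<in> regular_functions s H"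
    unfolding regular_functions_def
  proof (intro algebra_on_mult algebra_on_det)
    show "restrict (\<lambda>A. (\<chi> r c. if c = a then (if r = b then 1 else 0) else A i $ r $ c) $ k $ l) H
        \<in> algebra_on H (coordinate_functions s)" for k l
      using entry_regular[OF i, of k l H]
      by (cases "l = a") (simp_all add: regular_functions_def algebra_on.const)
    show "restrict (\<lambda>A. inverse (det (A i))) H \<in> algebra_on H (coordinate_functions s)"
      using inverse_det_regular[OF i] by (simp add: regular_functions_def)
  qed
  then show ?thesis by (simp add: matrix_inv_entry inv cong: restrict_cong)
qed

lemma regular_continuous_on:
  assumes "p \<in> regular_functions s H" and "\<And>A i. A \<in> H \<Longrightarrow> i < s \<Longrightarrow> invertible (A i)"
  shows "continuous_on H p"
  using assms(1)
proof (induction rule: regular_functions_induct)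
  case (entry i a b)
  have "continuous_on H (\<lambda>A. A i $ a $ b)"
    by (intro continuous_intros continuous_on_subset[OF continuous_on_product_coordinates]) auto
  then show ?case by (simp cong: continuous_on_cong)
next
  case (inverse_det i)
  have "continuous_on H (\<lambda>A. det (A i))"
    by (rule continuous_on_compose2[OF continuous_on_det[of UNIV]])
      (auto intro: continuous_on_subset[OF continuous_on_product_coordinates])
  then have "continuous_on H (\<lambda>A. inverse (det (A i)))"
    using assms(2)[OF _ inverse_det] by (intro continuous_intros) (auto simp: invertible_det_nz)
  then show ?case by (simp cong: continuous_on_cong)
next
  case (const c)
  then show ?case by (simp cong: continuous_on_cong)
next
  case (add p q)
  then have "continuous_on H (\<lambda>x. p x + q x)" by (intro continuous_intros)
  then show ?case by (simp cong: continuous_on_cong)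
next
  case (mult p q)
  then have "continuous_on H (\<lambda>x. p x * q x)" by (intro continuous_intros)
  then show ?case by (simp cong: continuous_on_cong)
qed

lemma conjugate_nth: "i < s \<Longrightarrow> conjugate s g A i = g ** A i ** matrix_inv g"
  by (simp add: conjugate_def)

lemma conjugate_conjugate:
  assumes "invertible g" "invertible h"
  shows "conjugate s g (conjugate s h A) = conjugate s (g ** h) A"
  using assms by (auto simp: conjugate_def matrix_inv_mult matrix_mul_assoc)

lemma matrix_inv_mat_1: "matrix_inv (mat 1 :: complex^'n^'n) = mat 1"
  by (rule matrix_inv_eqI) simp

lemma conjugate_one: "A \<in> extensional {..<s} \<Longrightarrow> conjugate s (mat 1) A = A"
  by (auto simp: conjugate_def matrix_inv_mat_1 extensional_def)

lemma det_conjugate: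
  assumes "invertible g" "i < s"
  shows "det (conjugate s g A i) = det (A i)"
proof -
  have "det g * det (matrix_inv g) = 1" using assms by (simp add: matrix_inv_right flip: det_mul)
  then show ?thesis using assms by (simp add: conjugate_nth det_mul mult_ac)
qed

lemma conjugate_entry:
  "i < s \<Longrightarrow> conjugate s g A i $ a $ b = (\<Sum>d\<in>UNIV. \<Sum>c\<in>UNIV. (g $ a $ c * matrix_inv g $ d $ b) * A i $ c $ d)"
  by (simp add: conjugate_nth matrix_matrix_mult_def sum_distrib_right sum_distrib_left mult_ac)

lemma continuous_on_conjugate:
  assumes "K \<subseteq> U_compact"
  shows "continuous_on K (\<lambda>g. conjugate s g A)"
proof (rule continuous_on_coordinatewise_then_product)
  fix i
  show "continuous_on K (\<lambda>g. conjugate s g A i)"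
  proof (cases "i < s")
    case True
    have "continuous_on K (\<lambda>g. g ** A i ** ctranspose g)"
      by (simp add: matrix_matrix_mult_def transpose_def) (intro continuous_intros)
    then show ?thesis
      using True assms by (simp add: conjugate_nth matrix_inv_unitary subset_iff cong: continuous_on_cong)
  qed (simp add: conjugate_def)
qed

text \<open>Conjugation acts linearly on the matrix entries and fixes the determinants, so the translates of a
polynomial in them lie in the span of finitely many such polynomials.\<close>

lemma regular_translates_span:
  assumes "p \<in> regular_functions s H"
    and conj: "\<And>g A. g \<in> G \<Longrightarrow> A \<in> H \<Longrightarrow> conjugate s g A \<in> H"
    and inv: "\<And>g. g \<in> G \<Longrightarrow> invertible g"
  shows "\<exists>E. finite E \<and> E \<subseteq> regular_functions s H
    \<and> (\<forall>g\<in>G. in_span H E (\<lambda>A. p (conjugate s g A)))"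
  using assms(1)
proof (induction rule: regular_functions_induct)
  case (entry i a b)
  let ?E = "(\<lambda>(c, d). restrict (\<lambda>A. A i $ c $ d) H) ` UNIV"
  have "in_span H ?E (\<lambda>A. restrict (\<lambda>A. A i $ a $ b) H (conjugate s g A))" if "g \<in> G" for g
  proof (rule in_span_cong)
    show "in_span H ?E (\<lambda>A. \<Sum>d\<in>UNIV. \<Sum>c\<in>UNIV. (g $ a $ c * matrix_inv g $ d $ b) * restrict (\<lambda>A. A i $ c $ d) H A)"
      by (intro in_span_sum in_span_scale in_span_base) (force simp del: restrict_apply)+
  qed (simp add: conjugate_entry entry conj that)
  then show ?case using entry_regular[OF entry] by (intro exI[of _ ?E]) auto
next
  case (inverse_det i)
  let ?f = "restrict (\<lambda>A. inverse (det (A i))) H"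
  have "in_span H {?f} (\<lambda>A. ?f (conjugate s g A))" if "g \<in> G" for g
  proof (rule in_span_cong)
    show "in_span H {?f} ?f" by (intro in_span_base) auto
  qed (simp add: conj that det_conjugate inv inverse_det)
  then show ?case using inverse_det_regular[OF inverse_det] by (intro exI[of _ "{?f}"]) auto
next
  case (const c)
  let ?f = "restrict (\<lambda>_. c) H"
  have "in_span H {?f} (\<lambda>A. ?f (conjugate s g A))" if "g \<in> G" for g
  proof (rule in_span_cong)
    show "in_span H {?f} ?f" by (intro in_span_base) auto
  qed (simp add: conj that)
  then show ?case by (intro exI[of _ "{?f}"]) (auto simp: regular_functions_def algebra_on.const)
next
  case (add p q)
  then obtain E F where E: "finite E" "E \<subseteq> regular_functions s H" "\<forall>g\<in>G. in_span H E (\<lambda>A. p (conjugate s g A))"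
    and F: "finite F" "F \<subseteq> regular_functions s H" "\<forall>g\<in>G. in_span H F (\<lambda>A. q (conjugate s g A))"
    by blast
  have "in_span H (E \<union> F) (\<lambda>A. restrict (\<lambda>x. p x + q x) H (conjugate s g A))" if "g \<in> G" for g
  proof (rule in_span_cong)
    show "in_span H (E \<union> F) (\<lambda>A. p (conjugate s g A) + q (conjugate s g A))"
      using E F that by (intro in_span_add) (auto intro: in_span_mono)
  qed (simp add: conj that)
  then show ?case using E F by (intro exI[of _ "E \<union> F"]) auto
next
  case (mult p q)
  then obtain E F where E: "finite E" "E \<subseteq> regular_functions s H" "\<forall>g\<in>G. in_span H E (\<lambda>A. p (conjugate s g A))"
    and F: "finite F" "F \<subseteq> regular_functions s H" "\<forall>g\<in>G. in_span H F (\<lambda>A. q (conjugate s g A))"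
    by blast
  let ?E = "(\<lambda>(e, f). restrict (\<lambda>x. e x * f x) H) ` (E \<times> F)"
  have "in_span H ?E (\<lambda>A. restrict (\<lambda>x. p x * q x) H (conjugate s g A))" if g: "g \<in> G" for g
  proof -
    obtain c where c: "\<forall>A\<in>H. p (conjugate s g A) = (\<Sum>e\<in>E. c e * e A)"
      using bspec[OF E(3) g] unfolding in_span_def by blast
    obtain d where d: "\<forall>A\<in>H. q (conjugate s g A) = (\<Sum>f\<in>F. d f * f A)"
      using bspec[OF F(3) g] unfolding in_span_def by blast
    show ?thesis
    proof (rule in_span_cong)
      show "in_span H ?E (\<lambda>A. \<Sum>e\<in>E. \<Sum>f\<in>F. (c e * d f) * restrict (\<lambda>x. e x * f x) H A)"
      proof (intro in_span_sum in_span_scale in_span_base)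
        show "finite ?E" using E F by simp
        show "restrict (\<lambda>x. e x * f x) H \<in> ?E" if "e \<in> E" "f \<in> F" for e f
          using that by (intro image_eqI[of _ _ "(e, f)"]) simp_all
      qed
    qed (simp add: conj g c d sum_product mult_ac)
  qed
  moreover have "?E \<subseteq> regular_functions s H"
    using E F by (auto simp: regular_functions_def intro!: algebra_on.mult)
  ultimately show ?case using E F by (intro exI[of _ ?E]) auto
qed

lemma regular_holomorphic_along_curve:
  assumes "p \<in> regular_functions s H" and A: "A \<in> H"
    and conj: "\<And>z. conjugate s (c z) A \<in> H"
    and inv: "\<And>z. invertible (c z)"
    and hol: "\<And>i j. (\<lambda>z. c z $ i $ j) holomorphic_on UNIV"
      "\<And>i j. (\<lambda>z. matrix_inv (c z) $ i $ j) holomorphic_on UNIV"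
  shows "(\<lambda>z. p (conjugate s (c z) A)) holomorphic_on UNIV"
  using assms(1)
proof (induction rule: regular_functions_induct)
  case (entry i a b)
  then show ?case
    by (simp add: conj conjugate_entry) (intro holomorphic_intros hol)
next
  case (inverse_det i)
  then show ?case by (simp add: conj det_conjugate inv)
next
  case (const d)
  then show ?case by (simp add: conj)
next
  case (add p q)
  then show ?case by (simp add: conj) (intro holomorphic_intros)
next
  case (mult p q)
  then show ?case by (simp add: conj) (intro holomorphic_intros)
qed

section \<open>Invariants separate the unitary orbits\<close>

text \<open>Stone-Weierstrass for the real functions that are restrictions of regular ones.  They separate
points because the real and imaginary parts of a matrix entry are among them: on unitary tuples the
complex conjugate of an entry is an entry of the inverse.\<close>

lemma regular_separates_compact:
  fixes H :: "(nat \<Rightarrow> 'm::finite cmatrix) set"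
  assumes ext: "H \<subseteq> extensional {..<s}"
    and inv: "\<And>A i. A \<in> H \<Longrightarrow> i < s \<Longrightarrow> invertible (A i)"
    and X: "compact X" and Y: "compact Y" and "X \<inter> Y = {}"
    and sub: "X \<union> Y \<subseteq> H"
    and unit: "\<And>A i. A \<in> X \<union> Y \<Longrightarrow> i < s \<Longrightarrow> A i \<in> U_compact"
  obtains p where "p \<in> regular_functions s H"
    "\<And>A. A \<in> X \<Longrightarrow> Re (p A) \<le> 1/4" "\<And>A. A \<in> Y \<Longrightarrow> Re (p A) \<ge> 3/4"
proof -
  define R where "R = {f. continuous_on (X \<union> Y) f \<and>
    (\<exists>p\<in>regular_functions s H. \<forall>A\<in>X \<union> Y. p A = complex_of_real (f A))}"
  interpret function_ring_on R "X \<union> Y"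
  proof
    show "compact (X \<union> Y)" using X Y by (rule compact_Un)
    show "continuous_on (X \<union> Y) f" if "f \<in> R" for f using that by (simp add: R_def)
    show "(\<lambda>A. f A + g A) \<in> R" if fg: "f \<in> R" "g \<in> R" for f g
    proof -
      obtain p q where p: "p \<in> regular_functions s H" "\<forall>A\<in>X \<union> Y. p A = complex_of_real (f A)"
        and q: "q \<in> regular_functions s H" "\<forall>A\<in>X \<union> Y. q A = complex_of_real (g A)"
        using fg unfolding R_def by blast
      have "restrict (\<lambda>x. p x + q x) H \<in> regular_functions s H"
        using p q by (simp add: regular_functions_def algebra_on.add)
      moreover have "\<forall>A\<in>X \<union> Y. restrict (\<lambda>x. p x + q x) H A = complex_of_real (f A + g A)"
        using p q sub by auto
      moreover have "continuous_on (X \<union> Y) (\<lambda>A. f A + g A)"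
        using fg by (intro continuous_intros) (auto simp: R_def)
      ultimately show ?thesis unfolding R_def by blast
    qed
    show "(\<lambda>A. f A * g A) \<in> R" if fg: "f \<in> R" "g \<in> R" for f g
    proof -
      obtain p q where p: "p \<in> regular_functions s H" "\<forall>A\<in>X \<union> Y. p A = complex_of_real (f A)"
        and q: "q \<in> regular_functions s H" "\<forall>A\<in>X \<union> Y. q A = complex_of_real (g A)"
        using fg unfolding R_def by blast
      have "restrict (\<lambda>x. p x * q x) H \<in> regular_functions s H"
        using p q by (simp add: regular_functions_def algebra_on.mult)
      moreover have "\<forall>A\<in>X \<union> Y. restrict (\<lambda>x. p x * q x) H A = complex_of_real (f A * g A)"
        using p q sub by auto
      moreover have "continuous_on (X \<union> Y) (\<lambda>A. f A * g A)"
        using fg by (intro continuous_intros) (auto simp: R_def)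
      ultimately show ?thesis unfolding R_def by blast
    qed
    show "(\<lambda>_. c) \<in> R" for c
    proof -
      have "restrict (\<lambda>_. complex_of_real c) H \<in> regular_functions s H"
        by (simp add: regular_functions_def algebra_on.const)
      moreover have "\<forall>A\<in>X \<union> Y. restrict (\<lambda>_. complex_of_real c) H A = complex_of_real c"
        using sub by auto
      ultimately show ?thesis unfolding R_def by (simp only: mem_Collect_eq continuous_on_const) blast
    qed
    show "\<exists>f\<in>R. f A \<noteq> f B" if A: "A \<in> X \<union> Y" and B: "B \<in> X \<union> Y" and ne: "A \<noteq> B" for A B
    proof -
      obtain i where i: "i < s" "A i \<noteq> B i"
        using ne A B sub ext extensionalityI[of A "{..<s}" B] by (auto simp: subset_iff)
      then obtain a b where ab: "A i $ a $ b \<noteq> B i $ a $ b" by (metis vec_eq_iff)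
      let ?z = "\<lambda>A :: nat \<Rightarrow> 'm cmatrix. A i $ a $ b" and ?w = "\<lambda>A :: nat \<Rightarrow> 'm cmatrix. matrix_inv (A i) $ b $ a"
      have z: "restrict ?z H \<in> algebra_on H (coordinate_functions s)"
        using entry_regular[OF i(1)] by (simp add: regular_functions_def)
      have w: "restrict ?w H \<in> algebra_on H (coordinate_functions s)"
      proof -
        have "invertible (A i)" if "A \<in> H" for A using that i(1) by (rule inv)
        with i(1) have "restrict ?w H \<in> regular_functions s H" by (rule inverse_entry_regular)
        then show ?thesis by (simp only: regular_functions_def)
      qed
      have cnj: "?w A = cnj (?z A)" if "A \<in> X \<union> Y" for A
        using unit[OF that i(1)] by (simp add: matrix_inv_unitary transpose_def)
      have cont: "continuous_on (X \<union> Y) ?z"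
        by (intro continuous_intros continuous_on_subset[OF continuous_on_product_coordinates]) auto
      have Re: "(\<lambda>A. Re (?z A)) \<in> R"
      proof -
        have "continuous_on (X \<union> Y) (\<lambda>A. Re (?z A))"
          using cont by (rule bounded_linear.continuous_on[OF bounded_linear_Re])
        moreover
        have "restrict (\<lambda>A. 1/2 * (?z A + ?w A)) H \<in> regular_functions s H"
          unfolding regular_functions_def by (intro algebra_on_scale algebra_on_add z w)
        moreover have "\<forall>A\<in>X \<union> Y. restrict (\<lambda>A. 1/2 * (?z A + ?w A)) H A = complex_of_real (Re (?z A))"
          using sub cnj by (auto simp: complex_eq_iff)
        ultimately show ?thesis unfolding R_def by blast
      qed
      have Im: "(\<lambda>A. Im (?z A)) \<in> R"
      proof -
        have "continuous_on (X \<union> Y) (\<lambda>A. Im (?z A))"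
          using cont by (rule bounded_linear.continuous_on[OF bounded_linear_Im])
        moreover
        have "restrict (\<lambda>A. (- \<i> / 2) * (?z A + (- 1) * ?w A)) H \<in> regular_functions s H"
          unfolding regular_functions_def by (intro algebra_on_scale algebra_on_add z w)
        moreover have "\<forall>A\<in>X \<union> Y. restrict (\<lambda>A. (- \<i> / 2) * (?z A + (- 1) * ?w A)) H A = complex_of_real (Im (?z A))"
          using sub cnj by (auto simp: complex_eq_iff)
        ultimately show ?thesis unfolding R_def by blast
      qed
      show ?thesis
      proof (cases "Re (?z A) = Re (?z B)")
        case True
        then have "Im (?z A) \<noteq> Im (?z B)" using ab by (simp add: complex_eq_iff)
        then show ?thesis using Im by (rule bexI[of "\<lambda>f. f A \<noteq> f B"])
      next
        case False
        then show ?thesis using Re by (rule bexI[of "\<lambda>f. f A \<noteq> f B"])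
      qed
    qed
  qed
  have "\<exists>f\<in>R. f ` (X \<union> Y) \<subseteq> {0..1} \<and> (\<forall>A\<in>X. f A < 1/4) \<and> (\<forall>A\<in>Y. f A > 1 - 1/4)"
    using X Y \<open>X \<inter> Y = {}\<close> by (intro two compact_imp_closed) auto
  then obtain f where f: "f \<in> R" "\<forall>A\<in>X. f A < 1/4" "\<forall>A\<in>Y. f A > 1 - 1/4"
    by blast
  then obtain p where p: "p \<in> regular_functions s H" "\<forall>A\<in>X \<union> Y. p A = complex_of_real (f A)"
    by (auto simp: R_def)
  show thesis
    by (rule that[OF p(1)]) (use p f in \<open>auto intro: less_imp_le\<close>)
qed

text \<open>Along the entire curve through \<open>g\<close> of lemma \<open>complex_curve\<close>, the values of \<open>p\<close> on the conjugates of \<open>A\<close>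
form an entire function that is constant on the imaginary axis, hence everywhere.\<close>

lemma (in polar_group) unitary_invariant_imp_invariant:
  assumes p: "p \<in> regular_functions s H"
    and conj: "\<And>g A. g \<in> G \<Longrightarrow> A \<in> H \<Longrightarrow> conjugate s g A \<in> H"
    and inv: "\<And>k A. k \<in> G \<inter> U_compact \<Longrightarrow> A \<in> H \<Longrightarrow> p (conjugate s k A) = p A"
  shows "p \<in> invariant_functions s G H"
proof -
  have "p (conjugate s g A) = p A" if g: "g \<in> G" and A: "A \<in> H" for g A
  proof -
    obtain c where c: "c 1 = g" "\<And>z. c z \<in> G" "\<And>z. Re z = 0 \<Longrightarrow> c z \<in> U_compact"
      and hol: "\<And>i j. (\<lambda>z. c z $ i $ j) holomorphic_on UNIV"
        "\<And>i j. (\<lambda>z. matrix_inv (c z) $ i $ j) holomorphic_on UNIV"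
      using complex_curve[OF g] by blast
    have "(\<lambda>z. p (conjugate s (c z) A)) holomorphic_on UNIV"
      using conj c A invertible by (intro regular_holomorphic_along_curve[OF p] hol) auto
    then have "(\<lambda>z. p (conjugate s (c z) A) - p A) holomorphic_on UNIV"
      by (intro holomorphic_intros)
    moreover have "0 islimpt {z. Re z = 0}"
      unfolding islimpt_approachable
    proof (intro allI impI)
      fix e :: real assume "e > 0"
      then show "\<exists>z\<in>{z. Re z = 0}. z \<noteq> 0 \<and> dist z 0 < e"
        by (intro bexI[of _ "\<i> * of_real (e / 2)"]) (auto simp: norm_mult)
    qed
    moreover have "p (conjugate s (c z) A) - p A = 0" if "z \<in> {z. Re z = 0}" for z
      using inv c that A by auto
    ultimately have "p (conjugate s (c 1) A) - p A = 0"
      using analytic_continuation[of "\<lambda>z. p (conjugate s (c z) A) - p A" UNIV "{z. Re z = 0}" 0 1] by auto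
    then show ?thesis by (simp add: c)
  qed
  then show ?thesis using p by (simp add: invariant_functions_def)
qed

context polar_group
begin

abbreviation (input) "compact_form \<equiv> G \<inter> U_compact"

lemma compact_form_closed:
  shows "mat 1 \<in> compact_form"
    and "k \<in> compact_form \<Longrightarrow> l \<in> compact_form \<Longrightarrow> k ** l \<in> compact_form"
    and "k \<in> compact_form \<Longrightarrow> matrix_inv k \<in> compact_form"
  by (auto simp: one_closed mult_closed unitary_one unitary_mult inv_closed unitary_matrix_inv)

definition orbit :: "nat \<Rightarrow> (nat \<Rightarrow> 'm cmatrix) \<Rightarrow> (nat \<Rightarrow> 'm cmatrix) set"
  where "orbit s A = (\<lambda>g. conjugate s g A) ` compact_form"

lemma conjugate_in_orbit: "k \<in> compact_form \<Longrightarrow> conjugate s k A \<in> orbit s A"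
  by (simp add: orbit_def)

lemma orbit_self: "A \<in> extensional {..<s} \<Longrightarrow> A \<in> orbit s A"
  using conjugate_in_orbit[OF compact_form_closed(1), of s A] by (simp add: conjugate_one)

lemma orbit_subset: "B \<in> orbit s A \<Longrightarrow> orbit s B \<subseteq> orbit s A"
  unfolding orbit_def using compact_form_closed(2) invertible by (force simp: conjugate_conjugate)

lemma orbit_sym:
  assumes "A \<in> extensional {..<s}" "B \<in> orbit s A"
  shows "A \<in> orbit s B"
proof -
  obtain k where k: "k \<in> compact_form" "B = conjugate s k A" using assms by (auto simp: orbit_def)
  then have "conjugate s (matrix_inv k) B = A"
    using assms compact_form_closed(3)[OF k(1)] invertible
    by (simp add: conjugate_conjugate matrix_inv_right conjugate_one)
  then show ?thesis using k compact_form_closed(3) conjugate_in_orbit by metis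
qed

lemma orbit_eq:
  assumes "A \<in> extensional {..<s}" "B \<in> orbit s A"
  shows "orbit s B = orbit s A"
  using orbit_subset[OF assms(2)] orbit_subset[OF orbit_sym[OF assms]] by (rule subset_antisym)

text \<open>Otherwise the orbits of \<open>A\<close> and \<open>B\<close> are disjoint, and a regular function \<open>p\<close> separates them.  Its
average \<open>q\<close> over the compact form is invariant, and by the bounds on \<open>p\<close> the real part of \<open>q\<close> is at
most \<open>1/4\<close> at \<open>A\<close> and at least \<open>3/4\<close> at \<open>B\<close>.\<close>

proposition invariants_separate_unitary_orbits:
  assumes ext: "H \<subseteq> extensional {..<s}"
    and HG: "\<And>A i. A \<in> H \<Longrightarrow> i < s \<Longrightarrow> A i \<in> G"
    and conj: "\<And>g A. g \<in> G \<Longrightarrow> A \<in> H \<Longrightarrow> conjugate s g A \<in> H"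
    and A: "A \<in> H" "\<And>i. i < s \<Longrightarrow> A i \<in> U_compact"
    and B: "B \<in> H" "\<And>i. i < s \<Longrightarrow> B i \<in> U_compact"
    and eq: "\<And>q. q \<in> invariant_functions s G H \<Longrightarrow> q A = q B"
  obtains k where "k \<in> G \<inter> U_compact" "conjugate s k A = B"
proof (rule ccontr)
  assume not: "\<not> thesis"
  let ?K = compact_form
  have inv: "invertible (A i)" if "A \<in> H" "i < s" for A i
    using HG invertible that by blast
  have comp: "conjugate s k (conjugate s l A) = conjugate s (k ** l) A" if "k \<in> ?K" "l \<in> ?K" for k l A
    using that invertible by (intro conjugate_conjugate) auto
  have compact: "compact (orbit s A)" for A
    unfolding orbit_def by (intro compact_continuous_image continuous_on_conjugate compact_unitary) auto
  have disj: "orbit s A \<inter> orbit s B = {}"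
  proof (rule ccontr)
    assume "orbit s A \<inter> orbit s B \<noteq> {}"
    then obtain C where "C \<in> orbit s A" "C \<in> orbit s B" by blast
    then have "orbit s A = orbit s B"
      using orbit_eq[of A s C] orbit_eq[of B s C] A(1) B(1) ext by blast
    then have "B \<in> orbit s A" using orbit_self[of B s] B(1) ext by blast
    then show False using not that unfolding orbit_def by blast
  qed
  have unit: "C i \<in> U_compact" if "C \<in> orbit s A \<union> orbit s B" "i < s" for C i
    using that A B by (auto simp: orbit_def conjugate_nth unitary_mult unitary_matrix_inv)
  have sub: "orbit s A \<union> orbit s B \<subseteq> H" using A B conj by (auto simp: orbit_def)
  obtain p where p: "p \<in> regular_functions s H" "\<And>C. C \<in> orbit s A \<Longrightarrow> Re (p C) \<le> 1/4"
    "\<And>C. C \<in> orbit s B \<Longrightarrow> Re (p C) \<ge> 3/4"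
  proof (rule regular_separates_compact[OF ext _ compact[of A] compact[of B] disj sub])
    show "invertible (C i)" if "C \<in> H" "i < s" for C i using that by (rule inv)
    show "C i \<in> U_compact" if "C \<in> orbit s A \<union> orbit s B" "i < s" for C i using that by (rule unit)
  qed blast
  obtain E where E: "finite E" "E \<subseteq> regular_functions s H"
    "\<And>g. g \<in> ?K \<Longrightarrow> in_span H E (\<lambda>A. p (conjugate s g A))"
    using regular_translates_span[OF p(1), of ?K] conj invertible by (metis IntD1)
  obtain q where q: "in_span H E q"
    and q_inv: "\<And>t C. t \<in> conjugate s ` ?K \<Longrightarrow> C \<in> H \<Longrightarrow> q (t C) = q C"
    and q_le: "\<And>C a. C \<in> H \<Longrightarrow> (\<And>t. t \<in> conjugate s ` ?K \<Longrightarrow> Re (p (t C)) \<le> a) \<Longrightarrow> Re (q C) \<le> a"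
    and q_ge: "\<And>C a. C \<in> H \<Longrightarrow> (\<And>t. t \<in> conjugate s ` ?K \<Longrightarrow> a \<le> Re (p (t C))) \<Longrightarrow> a \<le> Re (q C)"
  proof (rule bounded_group_average[of "conjugate s ` ?K" H E p])
    show "conjugate s ` ?K \<noteq> {}" using compact_form_closed(1) by blast
    show "t C \<in> H" if "t \<in> conjugate s ` ?K" "C \<in> H" for t C using that conj by auto
    show "t \<circ> t' \<in> conjugate s ` ?K" if tt': "t \<in> conjugate s ` ?K" "t' \<in> conjugate s ` ?K" for t t'
    proof -
      obtain k l where "k \<in> ?K" "l \<in> ?K" "t = conjugate s k" "t' = conjugate s l"
        using tt' by blast
      then have "t \<circ> t' = conjugate s (k ** l)" by (simp only: comp_def comp)
      then show ?thesis using compact_form_closed(2) \<open>k \<in> ?K\<close> \<open>l \<in> ?K\<close> by blast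
    qed
    show "\<exists>t'\<in>conjugate s ` ?K. \<forall>C\<in>H. t (t' C) = C" if t: "t \<in> conjugate s ` ?K" for t
    proof -
      obtain k where k: "k \<in> ?K" "t = conjugate s k" using t by blast
      have "t (conjugate s (matrix_inv k) C) = C" if "C \<in> H" for C
        using that k ext compact_form_closed(3)[OF k(1)] invertible
        by (simp add: comp matrix_inv_right conjugate_one subset_iff)
      then show ?thesis using compact_form_closed(3)[OF k(1)] by blast
    qed
    show "finite E" by fact
    show "in_span H E (\<lambda>C. p (t C))" if "t \<in> conjugate s ` ?K" for t using that E by auto
    show "bounded ((\<lambda>t. e (t C)) ` conjugate s ` ?K)" if e: "e \<in> E" and C: "C \<in> H" for e C
    proof -
      have "orbit s C \<subseteq> H" using conj C by (auto simp: orbit_def)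
      then have "continuous_on (orbit s C) e"
        using regular_continuous_on[of e s H] E e inv by (metis continuous_on_subset subsetD)
      then have "compact (e ` orbit s C)" using compact by (intro compact_continuous_image)
      then show ?thesis by (simp add: orbit_def image_image compact_imp_bounded)
    qed
  qed blast
  have "restrict q H \<in> regular_functions s H"
  proof -
    obtain c where c: "\<forall>C\<in>H. q C = (\<Sum>e\<in>E. c e * e C)" using q by (auto simp: in_span_def)
    have "restrict (\<lambda>C. \<Sum>e\<in>E. c e * e C) H \<in> regular_functions s H"
      unfolding regular_functions_def
    proof (intro algebra_on_sum algebra_on_scale)
      fix e assume "e \<in> E"
      then have "e \<in> algebra_on H (coordinate_functions s)"
        using E by (auto simp: regular_functions_def)
      then show "restrict e H \<in> algebra_on H (coordinate_functions s)"
        by (simp add: algebra_on_restrict)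
    qed
    then show ?thesis by (simp add: c cong: restrict_cong)
  qed
  then have "restrict q H \<in> invariant_functions s G H"
    by (rule unitary_invariant_imp_invariant) (simp_all add: conj q_inv)
  then have "q A = q B" using eq[of "restrict q H"] A B by simp
  moreover have "Re (q A) \<le> 1/4"
  proof (rule q_le[OF A(1)])
    fix t assume "t \<in> conjugate s ` ?K"
    then have "t A \<in> orbit s A" by (auto simp: orbit_def)
    then show "Re (p (t A)) \<le> 1/4" by (rule p)
  qed
  moreover have "Re (q B) \<ge> 3/4"
  proof (rule q_ge[OF B(1)])
    fix t assume "t \<in> conjugate s ` ?K"
    then have "t B \<in> orbit s B" by (auto simp: orbit_def)
    then show "3/4 \<le> Re (p (t B))" by (rule p)
  qed
  ultimately show False by simp
qed

end

section \<open>Quotient maps and the topology of representation spaces\<close>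

lemma quotient_maps_same_fibres_homeomorphic:
  assumes f: "quotient_map X Y f" and h: "quotient_map X Z h"
    and fib: "\<And>x y. x \<in> topspace X \<Longrightarrow> y \<in> topspace X \<Longrightarrow> f x = f y \<longleftrightarrow> h x = h y"
  shows "Y homeomorphic_space Z"
proof -
  note f_img = quotient_imp_surjective_map[OF f] and h_img = quotient_imp_surjective_map[OF h]
  have "\<exists>u. continuous_map Y Z u \<and> (\<forall>x\<in>topspace X. u (f x) = h x)"
  proof (rule quotient_map_lift_exists[OF f quotient_imp_continuous_map[OF h]])
    show "h x = h y" if "x \<in> topspace X" "y \<in> topspace X" "f x = f y" for x y
      using fib[of x y] that by simp
    fix u assume "continuous_map Y Z u" "\<And>x. x \<in> topspace X \<Longrightarrow> u (f x) = h x"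
    then show "\<exists>u. continuous_map Y Z u \<and> (\<forall>x\<in>topspace X. u (f x) = h x)" by auto
  qed
  then obtain u where u: "continuous_map Y Z u" "\<forall>x\<in>topspace X. u (f x) = h x" by blast
  have "\<exists>v. continuous_map Z Y v \<and> (\<forall>x\<in>topspace X. v (h x) = f x)"
  proof (rule quotient_map_lift_exists[OF h quotient_imp_continuous_map[OF f]])
    show "f x = f y" if "x \<in> topspace X" "y \<in> topspace X" "h x = h y" for x y
      using fib[of x y] that by simp
    fix v assume "continuous_map Z Y v" "\<And>x. x \<in> topspace X \<Longrightarrow> v (h x) = f x"
    then show "\<exists>v. continuous_map Z Y v \<and> (\<forall>x\<in>topspace X. v (h x) = f x)" by auto
  qed
  then obtain v where v: "continuous_map Z Y v" "\<forall>x\<in>topspace X. v (h x) = f x" by blast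
  have "v (u y) = y" if y: "y \<in> topspace Y" for y
  proof -
    obtain x where "x \<in> topspace X" "y = f x" using y unfolding f_img[symmetric] by blast
    then show ?thesis by (simp add: u v)
  qed
  moreover have "u (v z) = z" if z: "z \<in> topspace Z" for z
  proof -
    obtain x where "x \<in> topspace X" "z = h x" using z unfolding h_img[symmetric] by blast
    then show ?thesis by (simp add: u v)
  qed
  ultimately have "homeomorphic_maps Y Z u v"
    using u v by (simp add: homeomorphic_maps_def)
  then show ?thesis unfolding homeomorphic_space_def by blast
qed

text \<open>Tuples extended by \<open>undefined\<close> form a subspace of the full function space, so compactness and
continuity can be treated in the type class topology of functions.\<close>

lemma subtopology_product_eq_top_of_set:
  fixes K :: "'b::topological_space set" and H :: "('i \<Rightarrow> 'b) set"
  assumes H: "H \<subseteq> (\<Pi>\<^sub>E i\<in>I. K)"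
  shows "subtopology (product_topology (\<lambda>_. top_of_set K) I) H = top_of_set H"
proof -
  let ?X = "subtopology (product_topology (\<lambda>_. top_of_set K) I) H"
  have top: "topspace ?X = H" using H by auto
  have "continuous_map ?X (top_of_set H) id"
  proof -
    have "continuous_map ?X euclidean (\<lambda>x. x i)" for i
    proof (cases "i \<in> I")
      case True
      then have "continuous_map ?X (top_of_set K) (\<lambda>x. x i)"
        by (intro continuous_map_from_subtopology continuous_map_product_projection)
      then show ?thesis by (simp add: continuous_map_in_subtopology)
    next
      case False
      have "continuous_map ?X euclidean (\<lambda>_. undefined :: 'b)" by simp
      then show ?thesis
        by (rule continuous_map_eq) (use H False top in \<open>auto simp: PiE_def extensional_def\<close>)
    qed
    then have "continuous_map ?X (product_topology (\<lambda>_. euclidean) UNIV) (\<lambda>x. x)"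
      by (simp add: continuous_map_componentwise_UNIV)
    then show ?thesis
      using top by (simp add: euclidean_product_topology continuous_map_in_subtopology id_def)
  qed
  moreover have "continuous_map (top_of_set H) ?X id"
  proof -
    have "continuous_map (top_of_set H) (top_of_set K) (\<lambda>x. x i)" if "i \<in> I" for i
    proof -
      have "continuous_on H (\<lambda>x. x i)"
        by (rule continuous_on_subset[OF continuous_on_product_coordinates]) simp
      then show ?thesis using H that by auto
    qed
    then have "continuous_map (top_of_set H) (product_topology (\<lambda>_. top_of_set K) I) (\<lambda>x. x)"
      unfolding continuous_map_componentwise using H by (auto simp: PiE_def)
    then show ?thesis by (simp add: continuous_map_in_subtopology id_def)
  qed
  ultimately have "homeomorphic_maps ?X (top_of_set H) id id"
    by (simp add: homeomorphic_maps_def)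
  then show ?thesis by (simp add: homeomorphic_maps_id)
qed

text \<open>If each point lies in its own class, the union of a set of classes is its preimage under the class
map, and openness of this union is what defines the quotient topology.\<close>

lemma quotient_map_quotient_topology:
  assumes "disjoint (\<omega> ` topspace X)" and self: "\<And>x. x \<in> topspace X \<Longrightarrow> x \<in> \<omega> x"
    and sub: "\<And>x. x \<in> topspace X \<Longrightarrow> \<omega> x \<subseteq> topspace X"
  shows "quotient_map X (quotient_topology X (\<omega> ` topspace X)) \<omega>"
proof -
  let ?P = "\<omega> ` topspace X"
  let ?Q = "quotient_topology X ?P"
  note op = openin_quotient_topology[OF assms(1), of X]
  have "\<Union>?P = topspace X" using self sub by blast
  then have "openin ?Q ?P" by (simp add: op)
  then have "?P \<subseteq> topspace ?Q" by (rule openin_subset)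
  moreover have "topspace ?Q \<subseteq> ?P" using op[of "topspace ?Q"] by simp
  ultimately have top: "topspace ?Q = ?P" by (rule subset_antisym[rotated])
  have "{x \<in> topspace X. \<omega> x \<in> \<U>} = \<Union>\<U>" if \<U>: "\<U> \<subseteq> ?P" for \<U>
  proof (intro subset_antisym subsetI)
    fix x assume "x \<in> \<Union>\<U>"
    then obtain y where y: "y \<in> topspace X" "\<omega> y \<in> \<U>" "x \<in> \<omega> y" using \<U> by blast
    then have x: "x \<in> topspace X" using sub by blast
    then have "\<omega> x = \<omega> y" using disjointD[OF assms(1), of "\<omega> x" "\<omega> y"] y self[OF x] by blast
    then show "x \<in> {x \<in> topspace X. \<omega> x \<in> \<U>}" using x y by simp
  qed (use self in blast)
  then show ?thesis by (simp add: quotient_map_def top op)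
qed

lemma Hom_subset_PiE:
  assumes "\<gamma> ` {..<s} \<subseteq> carrier \<Gamma>"
  shows "Hom \<Gamma> s \<gamma> K \<subseteq> (\<Pi>\<^sub>E i\<in>{..<s}. K)"
  using assms by (auto simp: Hom_def hom_def matrix_group_def restrict_PiE_iff Pi_iff image_subset_iff
      simp del: restrict_apply)

lemma Hom_mono: "K \<subseteq> G \<Longrightarrow> Hom \<Gamma> s \<gamma> K \<subseteq> Hom \<Gamma> s \<gamma> G"
  unfolding Hom_def by (intro image_mono) (auto simp: hom_def matrix_group_def)

lemma conjugate_in_Hom:
  assumes A: "A \<in> Hom \<Gamma> s \<gamma> G" and g: "g \<in> G"
    and mult: "\<And>g h. g \<in> G \<Longrightarrow> h \<in> G \<Longrightarrow> g ** h \<in> G" and inv: "matrix_inv g \<in> G" "invertible g"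
  shows "conjugate s g A \<in> Hom \<Gamma> s \<gamma> G"
proof -
  obtain \<rho> where \<rho>: "\<rho> \<in> hom \<Gamma> (matrix_group G)" and A: "A = (\<lambda>i\<in>{..<s}. \<rho> (\<gamma> i))"
    using A by (auto simp: Hom_def)
  have "(\<lambda>x. g ** \<rho> x ** matrix_inv g) \<in> hom \<Gamma> (matrix_group G)"
  proof -
    have "g ** (M ** N) ** matrix_inv g = g ** M ** matrix_inv g ** (g ** N ** matrix_inv g)" for M N
    proof -
      have "g ** M ** matrix_inv g ** (g ** N ** matrix_inv g)
          = g ** M ** (matrix_inv g ** g) ** N ** matrix_inv g" by (simp only: matrix_mul_assoc)
      then show ?thesis using inv by (simp add: matrix_inv_right matrix_mul_assoc)
    qed
    then show ?thesis using \<rho> g mult inv by (auto simp: hom_def matrix_group_def Pi_iff)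
  qed
  then show ?thesis
    unfolding Hom_def by (rule rev_image_eqI) (auto simp: A conjugate_def)
qed

text \<open>The homomorphisms form a closed subset of the product of copies of \<open>K\<close> indexed by \<open>\<Gamma>\<close>, which is compact
by Tychonoff, and the tuples are its image under the evaluation at the generators.  This avoids
relations between the generators.\<close>

lemma compact_Hom:
  assumes "group \<Gamma>" and K: "compact K" and \<gamma>: "\<gamma> ` {..<s} \<subseteq> carrier \<Gamma>"
  shows "compact (Hom \<Gamma> s \<gamma> (K :: 'm::finite cmatrix set))"
proof -
  interpret group \<Gamma> by fact
  let ?c = "carrier \<Gamma>"
  \<comment> \<open>outside \<open>\<Gamma>\<close> a value must be fixed for compactness; the identity matrix serves\<close>
  define F where "F = (\<Pi>\<^sub>E x\<in>UNIV. if x \<in> ?c then K else {mat 1})"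
  define Z where "Z = {\<rho> :: 'a \<Rightarrow> 'm cmatrix. \<forall>x\<in>?c. \<forall>y\<in>?c. \<rho> (x \<otimes>\<^bsub>\<Gamma>\<^esub> y) = \<rho> x ** \<rho> y}"
  define r where "r \<rho> = (\<lambda>i\<in>{..<s}. \<rho> (\<gamma> i))" for \<rho> :: "'a \<Rightarrow> 'm cmatrix"
  have "compactin (product_topology (\<lambda>_. euclidean) UNIV) F"
    unfolding F_def using K by (subst compactin_PiE) auto
  then have "compact F" by (simp add: euclidean_product_topology)
  moreover have "closed Z"
  proof -
    have coord: "continuous_on UNIV (\<lambda>\<rho>. \<rho> x $ i $ j)" for x i j
      by (intro continuous_intros continuous_on_product_coordinates)
    have "continuous_on UNIV (\<lambda>\<rho> :: 'a \<Rightarrow> 'm cmatrix. \<rho> x ** \<rho> y)" for x y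
      unfolding matrix_matrix_mult_def
      by (intro continuous_on_vec_lambda continuous_on_sum continuous_on_mult coord)
    then show ?thesis
      unfolding Z_def Collect_ball_eq
      by (intro closed_INT ballI closed_Collect_eq continuous_on_product_coordinates)
  qed
  ultimately have "compact (F \<inter> Z)" by (rule compact_Int_closed)
  moreover have "continuous_on (F \<inter> Z) r"
  proof (rule continuous_on_coordinatewise_then_product)
    show "continuous_on (F \<inter> Z) (\<lambda>\<rho>. r \<rho> i)" for i
      by (cases "i < s") (auto simp: r_def intro: continuous_on_subset[OF continuous_on_product_coordinates])
  qed
  ultimately have "compact (r ` (F \<inter> Z))" by (rule compact_continuous_image[rotated])
  moreover have "r ` (F \<inter> Z) = Hom \<Gamma> s \<gamma> K"
  proof (intro subset_antisym subsetI)
    fix A assume "A \<in> r ` (F \<inter> Z)"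
    then obtain \<rho> where \<rho>: "\<rho> \<in> F" "\<rho> \<in> Z" "A = r \<rho>" by blast
    have "\<rho> x \<in> K" if "x \<in> ?c" for x using \<rho>(1) that by (auto simp: F_def PiE_def Pi_def split: if_splits)
    then have "\<rho> \<in> hom \<Gamma> (matrix_group K)"
      using \<rho>(2) by (auto simp: Z_def hom_def matrix_group_def)
    then show "A \<in> Hom \<Gamma> s \<gamma> K" using \<rho>(3) by (auto simp: Hom_def r_def)
  next
    fix A assume "A \<in> Hom \<Gamma> s \<gamma> K"
    then obtain \<rho> where \<rho>: "\<rho> \<in> hom \<Gamma> (matrix_group K)" "A = r \<rho>" by (auto simp: Hom_def r_def)
    define \<sigma> where "\<sigma> x = (if x \<in> ?c then \<rho> x else mat 1)" for x
    have "\<sigma> \<in> F \<inter> Z"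
      using \<rho>(1) by (auto simp: \<sigma>_def F_def Z_def hom_def matrix_group_def Pi_iff)
    moreover have "A = r \<sigma>"
      unfolding \<rho>(2) r_def \<sigma>_def using \<gamma> by (intro restrict_ext) auto
    ultimately show "A \<in> r ` (F \<inter> Z)" by blast
  qed
  ultimately show ?thesis by simp
qed


section \<open>The character variety as an orbit space\<close>

context polar_group
begin

text \<open>Both the projection and the orbit map are quotient maps from the compact space of unitary
representations.  They have the same fibres: orbits are contained in fibres as the generators \<open>f\<close> are
invariant, and conversely equal values of \<open>f\<close> give equal values of all invariants, which separate
the orbits.\<close>

theorem character_variety_homeomorphic:
  fixes \<Gamma> :: "('g, 'z) monoid_scheme"
  assumes \<Gamma>: "group \<Gamma>" and \<gamma>: "\<gamma> ` {..<s} \<subseteq> carrier \<Gamma>"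
    and K: "K = compact_form"
    and gen: "generates_invariants \<Gamma> s \<gamma> G k f"
  shows "compact_character_variety \<Gamma> s \<gamma> G K k f
    homeomorphic_space Hom_mod_conjugation \<Gamma> s \<gamma> K"
  unfolding K
proof -
  define HG where "HG = Hom \<Gamma> s \<gamma> G"
  define HK where "HK = Hom \<Gamma> s \<gamma> compact_form"
  let ?X = "top_of_set HK"
  let ?Y = "compact_character_variety \<Gamma> s \<gamma> G compact_form k f"
  have HGs: "HG \<subseteq> (\<Pi>\<^sub>E i\<in>{..<s}. G)" and HKs: "HK \<subseteq> (\<Pi>\<^sub>E i\<in>{..<s}. compact_form)"
    unfolding HG_def HK_def by (rule Hom_subset_PiE[OF \<gamma>])+
  have KG: "HK \<subseteq> HG" unfolding HG_def HK_def by (rule Hom_mono) simp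
  have ext: "HG \<subseteq> extensional {..<s}" using HGs by (auto simp: PiE_def)
  have HG: "A i \<in> G" if "A \<in> HG" "i < s" for A i using HGs that by (auto simp: PiE_def Pi_def)
  have HK: "A i \<in> U_compact" if "A \<in> HK" "i < s" for A i using HKs that by (auto simp: PiE_def Pi_def)
  have conjG: "conjugate s g A \<in> HG" if "g \<in> G" "A \<in> HG" for g A
    using that unfolding HG_def by (intro conjugate_in_Hom mult_closed inv_closed invertible)
  have conjK: "conjugate s g A \<in> HK" if "g \<in> compact_form" "A \<in> HK" for g A
    using that unfolding HK_def
    by (intro conjugate_in_Hom compact_form_closed invertible) auto
  have alg: "algebra_on HG (f ` {..<k}) = invariant_functions s G HG"
    using gen by (simp add: generates_invariants_def HG_def)
  have f_inv: "restrict (f j) HG \<in> invariant_functions s G HG" if "j < k" for j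
    using that by (simp add: algebra_on.gen flip: alg)
  have fibre: "projection k f A = projection k f B \<longleftrightarrow> orbit s A = orbit s B"
    if A: "A \<in> HK" and B: "B \<in> HK" for A B
  proof
    assume eq: "projection k f A = projection k f B"
    have fj: "f j A = f j B" if "j < k" for j
      using fun_cong[OF eq, of j] that by (simp add: projection_def)
    obtain g where "g \<in> compact_form" "conjugate s g A = B"
    proof (rule invariants_separate_unitary_orbits[OF ext])
      show "C i \<in> G" if "C \<in> HG" "i < s" for C i using that by (rule HG)
      show "conjugate s g C \<in> HG" if "g \<in> G" "C \<in> HG" for g C using that by (rule conjG)
      show "A \<in> HG" "B \<in> HG" using A B KG by auto
      show "A i \<in> U_compact" "B i \<in> U_compact" if "i < s" for i using HK A B that by auto
      show "q A = q B" if "q \<in> invariant_functions s G HG" for q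
        using that unfolding alg[symmetric]
        by (rule algebra_on_eqI) (use A B KG fj in auto)
    qed
    then have "B \<in> orbit s A" using conjugate_in_orbit by blast
    then show "orbit s A = orbit s B" using orbit_eq[of A s B] A KG ext by blast
  next
    assume "orbit s A = orbit s B"
    moreover have "B \<in> orbit s B" using B KG ext by (intro orbit_self) blast
    ultimately obtain g where g: "g \<in> compact_form" "B = conjugate s g A"
      by (auto simp: orbit_def)
    have "f j B = f j A" if "j < k" for j
    proof -
      have "restrict (f j) HG (conjugate s g A) = restrict (f j) HG A"
        using f_inv[OF that] g A KG by (auto simp: invariant_functions_def simp del: restrict_apply)
      moreover have "A \<in> HG" "conjugate s g A \<in> HG" using g A B KG by auto
      ultimately show ?thesis using g by simp
    qed
    then show "projection k f A = projection k f B" by (auto simp: projection_def intro: restrict_ext)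
  qed
  have Y: "?Y = subtopology (product_topology (\<lambda>_. euclidean) {..<k}) (projection k f ` HK)"
  proof -
    have "projection k f ` HG \<inter> projection k f ` HK = projection k f ` HK" using KG by blast
    then show ?thesis
      by (simp add: compact_character_variety_def git_quotient_def subtopology_subtopology
          flip: HG_def HK_def)
  qed
  have qY: "quotient_map ?X ?Y (projection k f)"
  proof (rule continuous_imp_quotient_map)
    have "compact HK"
      unfolding HK_def using \<Gamma> compact_unitary \<gamma> by (rule compact_Hom)
    then show "compact_space ?X" by (simp add: compact_space_subtopology)
    show "Hausdorff_space ?Y"
      unfolding Y by (intro Hausdorff_space_subtopology) (simp add: Hausdorff_space_product_topology)
    have "projection k f ` HK \<subseteq> (\<Pi>\<^sub>E j\<in>{..<k}. UNIV)"
      by (simp add: projection_def image_subset_iff restrict_PiE_iff del: restrict_apply)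
    then show "projection k f ` topspace ?X = topspace ?Y"
      unfolding Y by auto
    have "continuous_map ?X euclidean (f j)" if "j < k" for j
    proof -
      have "continuous_on HG (restrict (f j) HG)"
        using f_inv[OF that] HG invertible
        by (intro regular_continuous_on[of _ s]) (auto simp: invariant_functions_def simp del: restrict_apply)
      then have "continuous_on HK (restrict (f j) HG)" using KG by (rule continuous_on_subset)
      then have "continuous_on HK (f j)" using KG by (simp add: subset_iff cong: continuous_on_cong)
      then show ?thesis by simp
    qed
    then show "continuous_map ?X ?Y (projection k f)"
      unfolding Y continuous_map_in_subtopology continuous_map_componentwise
      by (auto simp: projection_def)
  qed
  have Q: "Hom_mod_conjugation \<Gamma> s \<gamma> compact_form = quotient_topology ?X (orbit s ` topspace ?X)"
    unfolding Hom_mod_conjugation_def Hom_topology_def conjugacy_orbits_def HK_def[symmetric]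
      subtopology_product_eq_top_of_set[OF HKs]
    by (simp add: orbit_def[abs_def])
  have qQ: "quotient_map ?X (quotient_topology ?X (orbit s ` topspace ?X)) (orbit s)"
  proof (rule quotient_map_quotient_topology)
    show "disjoint (orbit s ` topspace ?X)"
    proof (rule disjointI)
      fix P Q assume "P \<in> orbit s ` topspace ?X" "Q \<in> orbit s ` topspace ?X" "P \<noteq> Q"
      then obtain A B where AB: "A \<in> HK" "B \<in> HK" "P = orbit s A" "Q = orbit s B" by auto
      have "C \<notin> Q" if "C \<in> P" for C
        using orbit_eq[of A s C] orbit_eq[of B s C] AB that \<open>P \<noteq> Q\<close> KG ext by blast
      then show "P \<inter> Q = {}" by blast
    qed
    show "A \<in> orbit s A" if "A \<in> topspace ?X" for A
      using that KG ext by (intro orbit_self) auto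
    show "orbit s A \<subseteq> topspace ?X" if "A \<in> topspace ?X" for A
      using that conjK by (auto simp: orbit_def)
  qed
  have "?Y homeomorphic_space quotient_topology ?X (orbit s ` topspace ?X)"
    by (rule quotient_maps_same_fibres_homeomorphic[OF qY qQ]) (simp add: fibre)
  then show "?Y homeomorphic_space Hom_mod_conjugation \<Gamma> s \<gamma> compact_form"
    by (simp only: Q)
qed

end

theorem proposition5p3:
  fixes \<Gamma> :: "('g, 'z) monoid_scheme" and s :: nat and \<gamma> :: "nat \<Rightarrow> 'g"
  assumes "group \<Gamma>"
    and "\<gamma> ` {..<s} \<subseteq> carrier \<Gamma>"
    and "generate \<Gamma> (\<gamma> ` {..<s}) = carrier \<Gamma>"
  shows "(\<forall>(G :: 'n::finite cmatrix set, K) \<in> {(GL, U_compact), (SL, SU_compact),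
              (O_complex, O_compact), (SO_complex, SO_compact)}.
            \<forall>k f. generates_invariants \<Gamma> s \<gamma> G k f \<longrightarrow>
              compact_character_variety \<Gamma> s \<gamma> G K k f
                homeomorphic_space Hom_mod_conjugation \<Gamma> s \<gamma> K)
       \<and> (\<forall>(G :: ('n + 'n) cmatrix set, K) \<in> {(Sp_complex, Sp_compact)}.
            \<forall>k f. generates_invariants \<Gamma> s \<gamma> G k f \<longrightarrow>
              compact_character_variety \<Gamma> s \<gamma> G K k f
                homeomorphic_space Hom_mod_conjugation \<Gamma> s \<gamma> K)"
proof -
  have SO: "polar_group (SO_complex :: 'n cmatrix set)"
    unfolding SO_complex_def by (intro polar_group_Int polar_group_O polar_group_SL)
  note main = polar_group.character_variety_homeomorphic[OF _ assms(1,2)]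
  show ?thesis
    by (auto intro!: main GL_unitary[symmetric] polar_group_GL polar_group_SL polar_group_O SO polar_group_Sp
        simp: GL_unitary SU_compact_def O_compact_eq SO_compact_eq Sp_compact_def)
qed

end
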